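(* Let $L$ be a partial lattice on $n$ elements having a top element, and let $d$ be the maximum degree of any element of $L$. There is a data structure for $L$ that requires $O(n^{3/2})$ words of space and computes the join of two elements in $O\!\left(d\frac{\log n}{\log d}\right)$ time.
   Context: Model: word RAM with $\Theta(\log n)$-bit words; space measured in words. A partial lattice is a finite partially ordered set in which, whenever $x_1,x_2<y_1,y_2$, there exists $z$ with $x_1,x_2\le z\le y_1,y_2$; the join of $x,y$ is the unique least element of $\{z : z\ge x, z \ge y\}$. The transitive reduction graph of $L$ has an edge $(u,v)$ whenever $u<v$ and no $w$ satisfies $u<w<v$ (then $v$ covers $u$). The degree of an element is its number of in-neighbours in the transitive reduction graph, i.e. the number of elements it covers. The assumption that $L$ has a top element is a standing assumption of the section containing this result. *)

theory Defs
  imports Complex_Main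
begin

section \<open>Partial lattices\<close>

text \<open>
  A finite partially ordered set is a finite carrier \<open>A\<close> with its weak order \<open>r\<close>, given as a
  relation: \<open>(x, y) \<in> r\<close> means \<open>x \<le> y\<close>. Note that \<^const>\<open>partial_order_on\<close> entails \<open>r \<subseteq> A \<times> A\<close>.
\<close>

definition less_in :: "'a rel \<Rightarrow> 'a \<Rightarrow> 'a \<Rightarrow> bool" where
  "less_in r x y \<longleftrightarrow> (x, y) \<in> r \<and> x \<noteq> y"

definition partial_lattice :: "'a set \<Rightarrow> 'a rel \<Rightarrow> bool" where
  "partial_lattice A r \<longleftrightarrow> finite A \<and> partial_order_on A r \<and>
     (\<forall>x1\<in>A. \<forall>x2\<in>A. \<forall>y1\<in>A. \<forall>y2\<in>A.
        less_in r x1 y1 \<and> less_in r x1 y2 \<and> less_in r x2 y1 \<and> less_in r x2 y2 \<longrightarrow>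
        (\<exists>z\<in>A. (x1, z) \<in> r \<and> (x2, z) \<in> r \<and> (z, y1) \<in> r \<and> (z, y2) \<in> r))"

definition has_top :: "'a set \<Rightarrow> 'a rel \<Rightarrow> bool" where
  "has_top A r \<longleftrightarrow> (\<exists>t\<in>A. \<forall>x\<in>A. (x, t) \<in> r)"

definition is_join :: "'a set \<Rightarrow> 'a rel \<Rightarrow> 'a \<Rightarrow> 'a \<Rightarrow> 'a \<Rightarrow> bool" where
  "is_join A r x y z \<longleftrightarrow>
     z \<in> A \<and> (x, z) \<in> r \<and> (y, z) \<in> r \<and>
     (\<forall>u\<in>A. (x, u) \<in> r \<and> (y, u) \<in> r \<longrightarrow> (z, u) \<in> r)"

definition transitive_reduction :: "'a set \<Rightarrow> 'a rel \<Rightarrow> 'a rel" where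
  "transitive_reduction A r =
     {(u, v). u \<in> A \<and> v \<in> A \<and> less_in r u v \<and> \<not> (\<exists>w\<in>A. less_in r u w \<and> less_in r w v)}"

definition degree :: "'a set \<Rightarrow> 'a rel \<Rightarrow> 'a \<Rightarrow> nat" where
  "degree A r v = card {u. (u, v) \<in> transitive_reduction A r}"

definition max_degree :: "'a set \<Rightarrow> 'a rel \<Rightarrow> nat" where
  "max_degree A r = Max (degree A r ` A)"


section \<open>The word RAM\<close>

text \<open>
  Words of \<open>w\<close> bits are the natural numbers below \<open>2 ^ w\<close>. A program is a finite list of
  instructions, so it mentions only finitely many of the registers. Memory is a list of words that
  is addressed indirectly through registers; an access beyond its end is a fault. Hence the length
  of the list bounds all the memory that is available, including any scratch space.

  A word length of \<open>\<Theta>(log n)\<close> is rendered as \<open>a log (n + 1) \<le> w \<le> b log (n + 1)\<close>, with \<open>a\<close> a sufficiently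
  large constant (memory has to be addressable) and \<open>b\<close> an arbitrary one; \<open>n + 1\<close> instead of \<open>n\<close>
  matters only for \<open>n = 1\<close>.
\<close>

datatype binop = Add | Sub | Mul | Div | Mod | And | Or | Xor | Shl | Shr

primrec eval_binop :: "nat \<Rightarrow> binop \<Rightarrow> nat \<Rightarrow> nat \<Rightarrow> nat" where
  "eval_binop w Add a b = (a + b) mod 2 ^ w"
| "eval_binop w Sub a b = (a + 2 ^ w - b) mod 2 ^ w"
| "eval_binop w Mul a b = (a * b) mod 2 ^ w"
| "eval_binop w Div a b = a div b"
| "eval_binop w Mod a b = a mod b"
| "eval_binop w And a b = Bit_Operations.and a b"
| "eval_binop w Or a b = Bit_Operations.or a b"
| "eval_binop w Xor a b = Bit_Operations.xor a b"
| "eval_binop w Shl a b = push_bit b a mod 2 ^ w"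
| "eval_binop w Shr a b = drop_bit b a"

type_synonym reg = nat
type_synonym label = nat

text \<open>In all instructions with a destination register, it is the first argument.\<close>

datatype instr =
    Const reg nat
  | Move reg reg
  | Op binop reg reg reg
  | Load reg reg         \<comment> \<open>destination, address\<close>
  | Store reg reg        \<comment> \<open>address, value\<close>
  | Jump label
  | JumpEq reg reg label
  | JumpLess reg reg label
  | Halt

type_synonym program = "instr list"
type_synonym config = "label \<times> (reg \<Rightarrow> nat) \<times> nat list"

text \<open>\<^const>\<open>None\<close> means that no step is possible: the machine has halted or faulted.\<close>

fun step :: "nat \<Rightarrow> program \<Rightarrow> config \<Rightarrow> config option" where
  "step w P (pc, R, M) =
     (if pc < length P then
        (case P ! pc of
           Const i c \<Rightarrow> Some (pc + 1, R(i := c mod 2 ^ w), M)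
         | Move i j \<Rightarrow> Some (pc + 1, R(i := R j), M)
         | Op f i j k \<Rightarrow> Some (pc + 1, R(i := eval_binop w f (R j) (R k)), M)
         | Load i j \<Rightarrow>
             (if R j < length M then Some (pc + 1, R(i := M ! R j), M) else None)
         | Store i j \<Rightarrow>
             (if R i < length M then Some (pc + 1, R, M[R i := R j]) else None)
         | Jump l \<Rightarrow> Some (l, R, M)
         | JumpEq i j l \<Rightarrow> Some (if R i = R j then l else pc + 1, R, M)
         | JumpLess i j l \<Rightarrow> Some (if R i < R j then l else pc + 1, R, M)
         | Halt \<Rightarrow> None)
      else None)"

primrec run :: "nat \<Rightarrow> program \<Rightarrow> nat \<Rightarrow> config \<Rightarrow> config option" where
  "run w P 0 c = Some c"
| "run w P (Suc t) c = Option.bind (step w P c) (run w P t)"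

definition init_regs :: "nat \<Rightarrow> nat \<Rightarrow> reg \<Rightarrow> nat" where
  "init_regs x y = (\<lambda>_. 0)(0 := x, 1 := y)"

text \<open>
  \<open>answers w P M x y t z\<close>: on the query \<open>(x, y)\<close> the program reaches \<^const>\<open>Halt\<close> after exactly \<open>t\<close>
  steps with result \<open>z\<close> in register 0. It may write to memory meanwhile, but it leaves the stored
  data \<open>M\<close> as it found them, so that any number of queries can be answered one after another.
\<close>

definition answers :: "nat \<Rightarrow> program \<Rightarrow> nat list \<Rightarrow> nat \<Rightarrow> nat \<Rightarrow> nat \<Rightarrow> nat \<Rightarrow> bool" where
  "answers w P M x y t z \<longleftrightarrow>
     (\<exists>pc R. run w P t (0, init_regs x y, M) = Some (pc, R, M) \<and>
        pc < length P \<and> P ! pc = Halt \<and> R 0 = z)"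

text \<open>
  \<open>M\<close> is a data structure of at most \<open>s\<close> words of \<open>w\<close> bits for the order \<open>r\<close> on the identifiers
  \<open>0, \<dots>, n - 1\<close>, from which the query program \<open>P\<close> computes joins in time at most \<open>\<tau>\<close>.
\<close>

definition join_structure ::
  "nat \<Rightarrow> program \<Rightarrow> nat \<Rightarrow> nat rel \<Rightarrow> nat list \<Rightarrow> real \<Rightarrow> real \<Rightarrow> bool" where
  "join_structure w P n r M s \<tau> \<longleftrightarrow>
     real (length M) \<le> s \<and> (\<forall>v\<in>set M. v < 2 ^ w) \<and>
     (\<forall>x<n. \<forall>y<n. \<exists>t z. answers w P M x y t z \<and> is_join {..<n} r x y z \<and> real t \<le> \<tau>)"

text \<open>
  The quantity \<open>d log n / log d\<close> is meaningless for \<open>d \<le> 1\<close> (chains, given a top element) and would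
  be 0 for a single element. The two maxima give it a sensible value there. For \<open>d \<ge> 2\<close> they have
  no effect: then \<open>n > d\<close>, so that \<open>d log n / log d \<ge> d \<ge> 2\<close>.
\<close>

definition join_time :: "nat \<Rightarrow> nat \<Rightarrow> real" where
  "join_time n d = max 1 (real d * (log 2 (real n) / log 2 (real (max 2 d))))"

end

theory Submission
  imports Defs
begin

text \<open>
  The join of \<open>x\<close> and \<open>y\<close> is below \<open>v\<close> iff both \<open>x\<close> and \<open>y\<close> are, so a decision tree
  whose tests are \<open>x, y \<le> v\<close> finds it, and the tree does not depend on the query. Given a set of
  \<open>N\<close> candidates with a top element, first test the deepest \<open>v\<close> that has more than \<open>N / 2\<close> of them
  below it: a refutation halves the candidates. If \<open>v\<close> passes, test its children by decreasing
  number of candidates below them. The \<open>i\<close>-th child has at most \<open>N / max 2 i\<close> of them, so success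
  after \<open>i\<close> tests gains a factor \<open>max 2 i\<close>, and \<open>i / log i = O(d / log d)\<close>.

  Order tests take constant time: choose headers \<open>h\<^sub>0, h\<^sub>1, \<dots>\<close>, each minimal with at least \<open>q \<approx> \<surd>n\<close>
  elements below it that are not below an earlier header. There are \<open>O(\<surd>n)\<close> blocks, and inside a
  block all elements but the header have at most \<open>q\<close> elements below them. As \<open>v\<close> and a header
  have a meet as soon as they have a common lower bound, storing the meet of every \<open>v\<close> with every
  header reduces a test to membership in one of \<open>n\<close> sets of size at most \<open>q\<close>. Each of them gets a
  dictionary of \<open>O(q)\<close> words.
\<close>

subsection \<open>Static dictionaries by greedy displacement\<close>

lemma exists_few_collisions:
  fixes rw :: "'a \<Rightarrow> nat" and cl :: "'a \<Rightarrow> 'b"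
  assumes "finite X" "card X \<le> q" "0 < q" "inj_on (\<lambda>x. (rw x, cl x)) X" "finite J"
  shows "\<exists>d. (\<forall>j. d j < q) \<and>
    card {(x, y). x \<in> X \<and> y \<in> X \<and> cl x \<in> J \<and> cl y \<in> J \<and> x \<noteq> y \<and> rw x + d (cl x) = rw y + d (cl y)}
      \<le> 2 * card {x \<in> X. cl x \<in> J}"
  using \<open>finite J\<close>
proof (induction J rule: finite_induct)
  case empty
  show ?case using \<open>0 < q\<close> by (intro exI[of _ "\<lambda>_. 0"]) simp
next
  case (insert j J)
  define Y where "Y = {x \<in> X. cl x \<in> J}"
  define Z where "Z = {x \<in> X. cl x = j}"
  from insert.IH obtain d where d: "\<And>j. d j < q"
    and coll: "card {(x, y). x \<in> X \<and> y \<in> X \<and> cl x \<in> J \<and> cl y \<in> J \<and> x \<noteq> y \<and>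
      rw x + d (cl x) = rw y + d (cl y)} \<le> 2 * card Y"
    unfolding Y_def by blast
  define G where "G s = {(x, y). x \<in> Z \<and> y \<in> Y \<and> rw x + s = rw y + d (cl y)}" for s
  have fin: "finite Y" "finite Z" using \<open>finite X\<close> by (auto simp: Y_def Z_def)
  have finG: "finite (G s)" for s
    by (rule finite_subset[of _ "Z \<times> Y"]) (auto simp: G_def fin)
  have "(\<Sum>s<q. card (G s)) = card (\<Union>s<q. G s)"
    by (rule card_UN_disjoint[symmetric]) (auto simp: finG, auto simp: G_def)
  also have "\<dots> \<le> card (Z \<times> Y)"
    by (rule card_mono) (auto simp: fin G_def)
  also have "\<dots> \<le> card Z * q"
  proof -
    have "card Y \<le> card X" using \<open>finite X\<close> by (intro card_mono) (auto simp: Y_def)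
    then show ?thesis using \<open>card X \<le> q\<close> by (simp add: card_cartesian_product)
  qed
  finally have avg: "(\<Sum>s<q. card (G s)) \<le> card Z * q" .
  have "\<exists>s<q. card (G s) \<le> card Z"
  proof (rule ccontr)
    assume "\<not> ?thesis"
    then have "(\<Sum>s<q. card Z) < (\<Sum>s<q. card (G s))"
      using \<open>0 < q\<close> by (intro sum_strict_mono) (auto simp: not_le)
    with avg show False by (simp add: mult.commute)
  qed
  then obtain s where s: "s < q" "card (G s) \<le> card Z" by blast
  define d' where "d' = d(j := s)"
  let ?C = "{(x, y). x \<in> X \<and> y \<in> X \<and> cl x \<in> J \<and> cl y \<in> J \<and> x \<noteq> y \<and> rw x + d (cl x) = rw y + d (cl y)}"
  let ?D = "{(x, y). x \<in> X \<and> y \<in> X \<and> cl x \<in> insert j J \<and> cl y \<in> insert j J \<and> x \<noteq> y \<and>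
      rw x + d' (cl x) = rw y + d' (cl y)}"
  have finC: "finite ?C"
    by (rule finite_subset[of _ "X \<times> X"]) (auto simp: \<open>finite X\<close>)
  have "?D \<subseteq> ?C \<union> G s \<union> prod.swap ` G s"
  proof
    fix p assume "p \<in> ?D"
    then obtain x y where p: "p = (x, y)" and xy: "x \<in> X" "y \<in> X" "cl x \<in> insert j J"
      "cl y \<in> insert j J" "x \<noteq> y" "rw x + d' (cl x) = rw y + d' (cl y)" by blast
    consider "cl x = j" "cl y = j" | "cl x = j" "cl y \<in> J" | "cl x \<in> J" "cl y = j" | "cl x \<in> J" "cl y \<in> J"
      using xy by blast
    then show "p \<in> ?C \<union> G s \<union> prod.swap ` G s"
    proof cases
      case 1
      then have "rw x = rw y" using xy by simp
      with 1 xy assms(4) show ?thesis by (auto simp: inj_on_def)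
    next
      case 2
      then have "cl y \<noteq> j" using insert.hyps by auto
      with 2 xy have "(x, y) \<in> G s" by (auto simp: G_def Z_def Y_def d'_def)
      with p show ?thesis by blast
    next
      case 3
      then have "cl x \<noteq> j" using insert.hyps by auto
      with 3 xy have "(y, x) \<in> G s" by (auto simp: G_def Z_def Y_def d'_def)
      with p show ?thesis by force
    next
      case 4
      then have "cl x \<noteq> j" "cl y \<noteq> j" using insert.hyps by auto
      with 4 xy p show ?thesis by (auto simp: d'_def)
    qed
  qed
  then have "card ?D \<le> card (?C \<union> G s \<union> prod.swap ` G s)"
    using finC finG by (intro card_mono) auto
  also have "\<dots> \<le> card ?C + card (G s) + card (prod.swap ` G s)"
    by (meson add_le_mono card_Un_le le_refl le_trans)
  also have "\<dots> \<le> 2 * card Y + card Z + card Z"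
    using coll s(2) card_image_le[OF finG[of s], of prod.swap] by linarith
  also have "\<dots> = 2 * card {x \<in> X. cl x \<in> insert j J}"
  proof -
    have "{x \<in> X. cl x \<in> insert j J} = Y \<union> Z" by (auto simp: Y_def Z_def)
    moreover have "Y \<inter> Z = {}" using insert.hyps by (auto simp: Y_def Z_def)
    ultimately show ?thesis using fin by (simp add: card_Un_disjoint)
  qed
  finally have "card ?D \<le> 2 * card {x \<in> X. cl x \<in> insert j J}" .
  moreover have "\<forall>i. d' i < q" using d s by (simp add: d'_def)
  ultimately show ?case by blast
qed

text \<open>Inserting the buckets by decreasing size bounds the elements already placed when a bucket of
  size \<open>k\<close> is inserted: each of them takes part in at least \<open>k - 1\<close> collisions.\<close>

lemma exists_injective_displacement:
  fixes b :: "'a \<Rightarrow> 'b" and cl :: "'a \<Rightarrow> nat"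
  assumes X: "finite X" "card X \<le> q" "inj_on (\<lambda>x. (b x, cl x)) X"
    and coll: "card {(x, y). x \<in> X \<and> y \<in> X \<and> x \<noteq> y \<and> b x = b y} \<le> 2 * q"
    and "finite B"
  shows "\<exists>e. (\<forall>a. e a < 4 * q + 1) \<and> inj_on (\<lambda>x. e (b x) + cl x) {x \<in> X. b x \<in> B}"
  using \<open>finite B\<close>
proof (induction B rule: finite_ranking_induct[where f = "\<lambda>a. - int (card {x \<in> X. b x = a})"])
  case empty
  show ?case by (intro exI[of _ "\<lambda>_. 0"]) simp
next
  case (insert a B)
  show ?case
  proof (cases "a \<in> B")
    case True
    then show ?thesis using insert.IH by (simp add: insert_absorb)
  next
    case False
    from insert.IH obtain e where e: "\<And>i. e i < 4 * q + 1"
      and inj: "inj_on (\<lambda>x. e (b x) + cl x) {x \<in> X. b x \<in> B}" by blast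
    define Y where "Y = {x \<in> X. b x \<in> B}"
    define Z where "Z = {x \<in> X. b x = a}"
    define k where "k = card Z"
    have fin: "finite Y" "finite Z" using X(1) by (auto simp: Y_def Z_def)
    have "card Y * (k - 1) \<le> 2 * q"
    proof -
      have big: "k - 1 \<le> card ({y \<in> X. b y = b x} - {x})" if "x \<in> Y" for x
      proof -
        have "k \<le> card {y \<in> X. b y = b x}"
          using insert.hyps(2)[of "b x"] that by (auto simp: k_def Z_def Y_def)
        then show ?thesis using that X(1) by (auto simp: Y_def card_Diff_singleton_if)
      qed
      have "card Y * (k - 1) = (\<Sum>x\<in>Y. k - 1)" by simp
      also have "\<dots> \<le> (\<Sum>x\<in>Y. card ({y \<in> X. b y = b x} - {x}))" by (rule sum_mono) (rule big)
      also have "\<dots> = card (SIGMA x:Y. {y \<in> X. b y = b x} - {x})"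
        using X(1) by (intro card_SigmaI[symmetric]) (auto simp: fin)
      also have "\<dots> \<le> card {(x, y). x \<in> X \<and> y \<in> X \<and> x \<noteq> y \<and> b x = b y}"
        by (rule card_mono, rule finite_subset[of _ "X \<times> X"]) (auto simp: X(1) Y_def)
      finally show ?thesis using coll by simp
    qed
    moreover have "card Y \<le> q"
      using card_mono[of X Y] X by (auto simp: Y_def)
    ultimately have "k * card Y \<le> 4 * q"
    proof (cases "k \<le> 1")
      case True
      then have "k * card Y \<le> 1 * card Y" by (rule mult_le_mono1)
      then show ?thesis using \<open>card Y \<le> q\<close> by linarith
    next
      case False
      then have "k * card Y \<le> (2 * (k - 1)) * card Y" by (intro mult_le_mono1) simp
      also have "\<dots> = 2 * (card Y * (k - 1))" by (simp add: mult.commute)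
      finally show ?thesis using \<open>card Y * (k - 1) \<le> 2 * q\<close> by linarith
    qed
    define Bad where "Bad = (\<lambda>(x, y). e (b y) + cl y - cl x) ` (Z \<times> Y)"
    have "card Bad \<le> card (Z \<times> Y)" unfolding Bad_def by (rule card_image_le) (simp add: fin)
    also have "\<dots> \<le> 4 * q" using \<open>k * card Y \<le> 4 * q\<close> by (simp add: card_cartesian_product k_def)
    finally have "card Bad < card {..<4 * q + 1}" by simp
    moreover have "finite Bad" by (simp add: Bad_def fin)
    ultimately have "\<not> {..<4 * q + 1} \<subseteq> Bad" by (meson card_mono not_le)
    then obtain s where s: "s < 4 * q + 1" "s \<notin> Bad" by blast
    have free: "s + cl x \<noteq> e (b y) + cl y" if "x \<in> Z" "y \<in> Y" for x y
    proof
      assume "s + cl x = e (b y) + cl y"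
      then have "s = e (b y) + cl y - cl x" by simp
      then have "s \<in> Bad" unfolding Bad_def using that by force
      with s show False by simp
    qed
    have "inj_on (\<lambda>x. (e(a := s)) (b x) + cl x) {x \<in> X. b x \<in> insert a B}"
    proof (rule inj_onI)
      fix x y assume xy: "x \<in> {x \<in> X. b x \<in> insert a B}" "y \<in> {x \<in> X. b x \<in> insert a B}"
        and eq: "(e(a := s)) (b x) + cl x = (e(a := s)) (b y) + cl y"
      consider "b x = a" "b y = a" | "x \<in> Z" "y \<in> Y" | "x \<in> Y" "y \<in> Z" | "x \<in> Y" "y \<in> Y"
        using xy by (auto simp: Y_def Z_def)
      then show "x = y"
      proof cases
        case 1
        then show ?thesis using eq xy X(3) by (auto simp: inj_on_def)
      next
        case 2
        then have "b x = a" "b y \<noteq> a" using False by (auto simp: Y_def Z_def)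
        then show ?thesis using free[OF 2] eq by simp
      next
        case 3
        then have "b x \<noteq> a" "b y = a" using False by (auto simp: Y_def Z_def)
        then show ?thesis using free[OF 3(2,1)] eq by simp
      next
        case 4
        then have "b x \<noteq> a" "b y \<noteq> a" using False by (auto simp: Y_def)
        then show ?thesis using inj eq 4 by (auto simp: Y_def inj_on_def)
      qed
    qed
    then show ?thesis using e s by (intro exI[of _ "e(a := s)"]) simp
  qed
qed

definition dict_pos :: "nat \<Rightarrow> (nat \<Rightarrow> nat) \<Rightarrow> (nat \<Rightarrow> nat) \<Rightarrow> nat \<Rightarrow> nat" where
  "dict_pos q d e x = e (x div q + d (x mod q)) + x mod q"

lemma exists_dictionary:
  assumes "X \<subseteq> {..<q * q}" "card X \<le> q" "0 < q"
  shows "\<exists>d e. (\<forall>j. d j < q) \<and> (\<forall>a. e a < 4 * q + 1) \<and> inj_on (dict_pos q d e) X"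
proof -
  have fin: "finite X" using assms(1) finite_subset by blast
  have inj: "inj_on (\<lambda>x. (x div q, x mod q)) X"
    by (rule inj_onI) (metis div_mult_mod_eq prod.inject)
  from exists_few_collisions[OF fin assms(2,3) inj, of "{..<q}"]
  obtain d where d: "\<And>j. d j < q"
    and "card {(x, y). x \<in> X \<and> y \<in> X \<and> x mod q \<in> {..<q} \<and> y mod q \<in> {..<q} \<and> x \<noteq> y \<and>
      x div q + d (x mod q) = y div q + d (y mod q)} \<le> 2 * card {x \<in> X. x mod q \<in> {..<q}}"
    by auto
  with assms have coll: "card {(x, y). x \<in> X \<and> y \<in> X \<and> x \<noteq> y \<and>
      x div q + d (x mod q) = y div q + d (y mod q)} \<le> 2 * q"
    by simp
  have inj2: "inj_on (\<lambda>x. (x div q + d (x mod q), x mod q)) X"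
    by (rule inj_onI) (metis add_right_cancel div_mult_mod_eq prod.inject)
  have "\<exists>e. (\<forall>a. e a < 4 * q + 1) \<and> inj_on (\<lambda>x. e (x div q + d (x mod q)) + x mod q)
      {x \<in> X. x div q + d (x mod q) \<in> (\<lambda>x. x div q + d (x mod q)) ` X}"
    by (rule exists_injective_displacement[OF fin assms(2) inj2 coll]) (simp add: fin)
  moreover have "{x \<in> X. x div q + d (x mod q) \<in> (\<lambda>x. x div q + d (x mod q)) ` X} = X" by blast
  ultimately show ?thesis using d unfolding dict_pos_def[abs_def] by auto
qed

subsection \<open>Partial lattices\<close>

lemma partial_latticeD:
  assumes "partial_lattice A r"
  shows "finite A" "\<And>x. x \<in> A \<Longrightarrow> (x, x) \<in> r" "\<And>x y. (x, y) \<in> r \<Longrightarrow> x \<in> A \<and> y \<in> A"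
    "\<And>x y z. (x, y) \<in> r \<Longrightarrow> (y, z) \<in> r \<Longrightarrow> (x, z) \<in> r"
    "\<And>x y. (x, y) \<in> r \<Longrightarrow> (y, x) \<in> r \<Longrightarrow> x = y"
    "\<And>x1 x2 y1 y2. less_in r x1 y1 \<Longrightarrow> less_in r x1 y2 \<Longrightarrow> less_in r x2 y1 \<Longrightarrow> less_in r x2 y2 \<Longrightarrow>
       \<exists>z\<in>A. (x1, z) \<in> r \<and> (x2, z) \<in> r \<and> (z, y1) \<in> r \<and> (z, y2) \<in> r"
proof -
  have *: "finite A" "refl_on A r" "trans r" "antisym r" "r \<subseteq> A \<times> A"
    using assms by (auto simp: partial_lattice_def partial_order_on_def preorder_on_def refl_on_def)
  then show "finite A" "\<And>x. x \<in> A \<Longrightarrow> (x, x) \<in> r"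
    and field: "\<And>x y. (x, y) \<in> r \<Longrightarrow> x \<in> A \<and> y \<in> A"
    and "\<And>x y z. (x, y) \<in> r \<Longrightarrow> (y, z) \<in> r \<Longrightarrow> (x, z) \<in> r"
    and "\<And>x y. (x, y) \<in> r \<Longrightarrow> (y, x) \<in> r \<Longrightarrow> x = y"
    by (auto simp: refl_on_def dest: transD antisymD)
  show "\<And>x1 x2 y1 y2. less_in r x1 y1 \<Longrightarrow> less_in r x1 y2 \<Longrightarrow> less_in r x2 y1 \<Longrightarrow> less_in r x2 y2 \<Longrightarrow>
       \<exists>z\<in>A. (x1, z) \<in> r \<and> (x2, z) \<in> r \<and> (z, y1) \<in> r \<and> (z, y2) \<in> r"
    using assms unfolding partial_lattice_def by (metis field less_in_def)
qed

lemma partial_lattice_converse: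
  assumes "partial_lattice A r"
  shows "partial_lattice A (r\<inverse>)"
proof -
  have "partial_order_on A (r\<inverse>)" "finite A"
    using assms by (auto simp: partial_lattice_def)
  moreover have "less_in (r\<inverse>) x y \<longleftrightarrow> less_in r y x" for x y by (auto simp: less_in_def)
  ultimately show ?thesis
    using partial_latticeD(6)[OF assms] unfolding partial_lattice_def by (simp; metis)
qed

lemma exists_join:
  assumes L: "partial_lattice A r" and ub: "(x, t) \<in> r" "(y, t) \<in> r"
  shows "\<exists>z. is_join A r x y z"
proof -
  note L = partial_latticeD[OF L]
  define U where "U = {u \<in> A. (x, u) \<in> r \<and> (y, u) \<in> r}"
  define z where "z = arg_min (\<lambda>u. card {v \<in> A. (v, u) \<in> r}) (\<lambda>u. u \<in> U)"
  have "t \<in> U" using ub L(3) by (auto simp: U_def)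
  then have z: "z \<in> U" "\<And>u. u \<in> U \<Longrightarrow> card {v \<in> A. (v, z) \<in> r} \<le> card {v \<in> A. (v, u) \<in> r}"
    unfolding z_def by (auto intro: arg_min_natI arg_min_nat_le)
  have min: "u = z" if "u \<in> U" "(u, z) \<in> r" for u
  proof (rule ccontr)
    assume "u \<noteq> z"
    then have "(z, u) \<notin> r" using L(5) that by blast
    moreover have "(z, z) \<in> r" "z \<in> A" using z(1) L(2) by (auto simp: U_def)
    ultimately have "{v \<in> A. (v, u) \<in> r} \<subset> {v \<in> A. (v, z) \<in> r}" using that L(4) by blast
    then have "card {v \<in> A. (v, u) \<in> r} < card {v \<in> A. (v, z) \<in> r}"
      using L(1) by (intro psubset_card_mono) auto
    with z(2)[OF that(1)] show False by simp
  qed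
  have "(z, u) \<in> r" if "u \<in> U" for u
  proof (cases "less_in r x z \<and> less_in r y z \<and> less_in r x u \<and> less_in r y u")
    case True
    then obtain w where "w \<in> A" "(x, w) \<in> r" "(y, w) \<in> r" "(w, z) \<in> r" "(w, u) \<in> r"
      using L(6)[of x z u y] by blast
    with min[of w] show ?thesis by (auto simp: U_def)
  next
    case False
    have "x \<in> U" if "(y, x) \<in> r" using that L(2,3) by (auto simp: U_def)
    moreover have "y \<in> U" if "(x, y) \<in> r" using that L(2,3) by (auto simp: U_def)
    ultimately show ?thesis
      using False that z(1) min[of x] min[of y] min[of u] by (auto simp: U_def less_in_def)
  qed
  with z(1) show ?thesis by (auto simp: is_join_def U_def)
qed

lemma exists_meet:
  assumes L: "partial_lattice A r" and lb: "(t, x) \<in> r" "(t, y) \<in> r"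
  shows "\<exists>z\<in>A. \<forall>u. (u, z) \<in> r \<longleftrightarrow> (u, x) \<in> r \<and> (u, y) \<in> r"
proof -
  have "\<exists>z. is_join A (r\<inverse>) x y z"
    by (rule exists_join[OF partial_lattice_converse[OF L], of x t y]) (use lb in auto)
  then obtain z where "z \<in> A" "(z, x) \<in> r" "(z, y) \<in> r"
    "\<And>u. (u, x) \<in> r \<Longrightarrow> (u, y) \<in> r \<Longrightarrow> (u, z) \<in> r"
    using partial_latticeD(3)[OF L] by (auto simp: is_join_def)
  then show ?thesis using partial_latticeD(4)[OF L] by blast
qed

subsection \<open>Order testing\<close>

text \<open>The blocks of a list of headers are the sets \<open>\<down>h\<^sub>i - (\<down>h\<^sub>0 \<union> \<dots> \<union> \<down>h\<^sub>i\<^sub>-\<^sub>1)\<close>.\<close>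

inductive headers :: "'a rel \<Rightarrow> nat \<Rightarrow> 'a list \<Rightarrow> bool" for r q where
  headers_Nil: "headers r q []"
| headers_snoc: "headers r q hs \<Longrightarrow>
    q \<le> card {x. (x, h) \<in> r \<and> (\<forall>g\<in>set hs. (x, g) \<notin> r)} \<Longrightarrow>
    (\<And>m. (m, h) \<in> r \<Longrightarrow> m \<noteq> h \<Longrightarrow> card {x. (x, m) \<in> r \<and> (\<forall>g\<in>set hs. (x, g) \<notin> r)} \<le> q) \<Longrightarrow>
    headers r q (hs @ [h])"

lemma headers_length:
  assumes "headers r q hs" "finite A" "r \<subseteq> A \<times> A"
  shows "length hs * q \<le> card {x \<in> A. \<exists>g\<in>set hs. (x, g) \<in> r}"
  using assms(1)
proof induction
  case headers_Nil
  show ?case by simp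
next
  case (headers_snoc hs h)
  let ?U = "{x \<in> A. \<exists>g\<in>set hs. (x, g) \<in> r}" and ?N = "{x. (x, h) \<in> r \<and> (\<forall>g\<in>set hs. (x, g) \<notin> r)}"
  have N: "finite ?N" by (rule finite_subset[of _ A]) (use assms in auto)
  have "length (hs @ [h]) * q \<le> card ?U + card ?N" using headers_snoc by auto
  also have "\<dots> = card (?U \<union> ?N)"
    using N assms(2) by (intro card_Un_disjoint[symmetric]) auto
  also have "?U \<union> ?N = {x \<in> A. \<exists>g\<in>set (hs @ [h]). (x, g) \<in> r}" using assms(3) by auto
  finally show ?case using headers_snoc by simp
qed

lemma headers_block:
  assumes "headers r q hs" "i < length hs" "(m, hs ! i) \<in> r" "m \<noteq> hs ! i"
  shows "card {x. (x, m) \<in> r \<and> (\<forall>j<i. (x, hs ! j) \<notin> r)} \<le> q"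
  using assms
proof induction
  case headers_Nil
  then show ?case by simp
next
  case (headers_snoc hs h)
  show ?case
  proof (cases "i < length hs")
    case True
    then show ?thesis using headers_snoc by (auto simp: nth_append)
  next
    case False
    then have i: "i = length hs" using headers_snoc by simp
    have "(\<forall>j<i. (x, (hs @ [h]) ! j) \<notin> r) \<longleftrightarrow> (\<forall>g\<in>set hs. (x, g) \<notin> r)" for x
      unfolding i by (simp add: all_set_conv_all_nth nth_append)
    then show ?thesis using headers_snoc i by simp
  qed
qed

lemma exists_maximal_headers:
  assumes L: "partial_lattice A r" and "0 < q"
  shows "\<exists>hs. headers r q hs \<and> (\<forall>m. card {x. (x, m) \<in> r \<and> (\<forall>g\<in>set hs. (x, g) \<notin> r)} < q)"
proof -
  note L = partial_latticeD[OF L]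
  have sub: "r \<subseteq> A \<times> A" using L(3) by auto
  have bound: "length hs \<le> card A" if "headers r q hs" for hs
  proof -
    have "length hs * 1 \<le> length hs * q" using \<open>0 < q\<close> by (intro mult_le_mono2) simp
    also have "\<dots> \<le> card A"
      using headers_length[OF that L(1) sub] card_mono[OF L(1), of "{x \<in> A. \<exists>g\<in>set hs. (x, g) \<in> r}"] by force
    finally show ?thesis by simp
  qed
  define hs where "hs = (ARG_MAX length hs. headers r q hs)"
  have hs: "headers r q hs" "\<And>gs. headers r q gs \<Longrightarrow> length gs \<le> length hs"
    unfolding hs_def
    using arg_max_natI[of "headers r q" "[]" length "Suc (card A)"]
      arg_max_nat_le[of "headers r q" _ length "Suc (card A)"] bound headers_Nil[of r q]
    by (auto simp: less_Suc_eq_le)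
  define D where "D m = {x. (x, m) \<in> r \<and> (\<forall>g\<in>set hs. (x, g) \<notin> r)}" for m
  have finD: "finite (D m)" for m
    by (rule finite_subset[of _ A]) (use L in \<open>auto simp: D_def\<close>)
  have "card (D m) < q" for m
  proof (rule ccontr)
    assume "\<not> card (D m) < q"
    define h where "h = (ARG_MIN (\<lambda>h. card (D h)) h. q \<le> card (D h))"
    have h: "q \<le> card (D h)" "\<And>g. q \<le> card (D g) \<Longrightarrow> card (D h) \<le> card (D g)"
      unfolding h_def using \<open>\<not> card (D m) < q\<close>
      by (auto intro: arg_min_natI[of "\<lambda>h. q \<le> card (D h)" m] arg_min_nat_le)
    then have "D h \<noteq> {}" using \<open>0 < q\<close> by auto
    then have hD: "h \<in> D h" using L unfolding D_def by blast
    have "card (D g) \<le> q" if "(g, h) \<in> r" "g \<noteq> h" for g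
    proof -
      have "h \<notin> D g" using that L(5) by (auto simp: D_def)
      moreover have "D g \<subseteq> D h" using that L(4) by (auto simp: D_def)
      ultimately have "card (D g) < card (D h)" using hD finD by (intro psubset_card_mono) auto
      then show ?thesis using h(2)[of g] by linarith
    qed
    then have "headers r q (hs @ [h])"
      using hs(1) h(1) by (intro headers_snoc) (auto simp: D_def)
    from hs(2)[OF this] show False by simp
  qed
  with hs(1) show ?thesis by (auto simp: D_def)
qed

text \<open>\<open>E v i\<close> is \<^const>\<open>None\<close> if the header of block \<open>i\<close> is below \<open>v\<close>, and otherwise names the
  set of the meet of \<open>v\<close> with this header, where \<open>n\<close> stands for a missing meet.\<close>

lemma exists_order_oracle:
  fixes r :: "nat rel"
  assumes L: "partial_lattice {..<n} r" and top: "has_top {..<n} r" and "n \<le> q * q" "0 < q"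
  shows "\<exists>k b (E :: nat \<Rightarrow> nat \<Rightarrow> nat option) X. k \<le> q + 1 \<and> (\<forall>x<n. b x < k) \<and>
    (\<forall>m. X m \<subseteq> {..<n} \<and> card (X m) \<le> q) \<and> (\<forall>v i m. E v i = Some m \<longrightarrow> m \<le> n) \<and>
    (\<forall>x<n. \<forall>v<n. (x, v) \<in> r \<longleftrightarrow> (\<forall>m. E v (b x) = Some m \<longrightarrow> x \<in> X m))"
proof -
  note L' = partial_latticeD[OF L]
  obtain hs where hs: "headers r q hs"
    "\<And>m. card {x. (x, m) \<in> r \<and> (\<forall>g\<in>set hs. (x, g) \<notin> r)} < q"
    using exists_maximal_headers[OF L \<open>0 < q\<close>] by blast
  obtain t where t: "t < n" "\<And>x. x < n \<Longrightarrow> (x, t) \<in> r" using top by (auto simp: has_top_def)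
  define gs where "gs = hs @ [t]"
  define b where "b x = (LEAST i. (x, gs ! i) \<in> r)" for x
  define X where "X m = (if card {x. (x, m) \<in> r \<and> b x = b m} \<le> q then {x. (x, m) \<in> r \<and> b x = b m} else {})" for m
  define meet where "meet v h g \<longleftrightarrow> g < n \<and> (\<forall>u. (u, g) \<in> r \<longleftrightarrow> (u, v) \<in> r \<and> (u, h) \<in> r)" for v h g
  define E where "E v i = (if (gs ! i, v) \<in> r then None
    else if \<exists>g. meet v (gs ! i) g then Some (SOME g. meet v (gs ! i) g) else Some n)" for v i
  have "length hs * q \<le> card {x \<in> {..<n}. \<exists>g\<in>set hs. (x, g) \<in> r}"
    using headers_length[OF hs(1)] L'(3) by fastforce
  also have "\<dots> \<le> n" using card_mono[of "{..<n}" "{x \<in> {..<n}. \<exists>g\<in>set hs. (x, g) \<in> r}"] by force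
  finally have "length hs * q \<le> q * q" using \<open>n \<le> q * q\<close> by linarith
  then have "length hs \<le> q" using \<open>0 < q\<close> by simp
  have gs_top: "(x, gs ! length hs) \<in> r" if "x < n" for x using t that by (simp add: gs_def)
  have b: "(x, gs ! b x) \<in> r" "b x \<le> length hs" if "x < n" for x
    unfolding b_def using gs_top[OF that] by (rule LeastI) (rule Least_le, rule gs_top[OF that])
  have b_least: "b x \<le> i" if "(x, gs ! i) \<in> r" for x i
    unfolding b_def using that by (rule Least_le)
  have b_mono: "b x \<le> b y" if "(x, y) \<in> r" for x y
    using that b(1)[of y] L'(3,4) by (intro b_least) blast
  have small: "X m = {x. (x, m) \<in> r \<and> b x = b m}" if "m < n" "m \<noteq> gs ! b m" for m
  proof -
    have finm: "finite {x. (x, m) \<in> r \<and> P x}" for P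
      by (rule finite_subset[of _ "{..<n}"]) (use L'(3) in auto)
    have "card {x. (x, m) \<in> r \<and> b x = b m} \<le> card {x. (x, m) \<in> r \<and> (\<forall>j<b m. (x, gs ! j) \<notin> r)}"
      by (rule card_mono[OF finm]) (auto dest: b_least)
    also have "\<dots> \<le> q"
    proof (cases "b m < length hs")
      case True
      then have "card {x. (x, m) \<in> r \<and> (\<forall>j<b m. (x, hs ! j) \<notin> r)} \<le> q"
        using that b(1)[of m] by (intro headers_block[OF hs(1)]) (auto simp: gs_def nth_append)
      then show ?thesis using True by (simp add: gs_def nth_append)
    next
      case False
      then have "b m = length hs" using b(2)[OF that(1)] by simp
      then have "(\<forall>j<b m. (x, gs ! j) \<notin> r) \<longleftrightarrow> (\<forall>g\<in>set hs. (x, g) \<notin> r)" for x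
        by (simp add: all_set_conv_all_nth nth_append gs_def)
      then show ?thesis using hs(2)[of m] by simp
    qed
    finally show ?thesis by (simp add: X_def)
  qed
  have X_sub: "x \<in> X m \<Longrightarrow> (x, m) \<in> r \<and> b x = b m" for x m
    by (auto simp: X_def split: if_splits)
  have Xn: "X n = {}" using X_sub L'(3) by blast
  have "(x, v) \<in> r \<longleftrightarrow> (\<forall>m. E v (b x) = Some m \<longrightarrow> x \<in> X m)" if "x < n" "v < n" for x v
  proof -
    let ?h = "gs ! b x"
    consider "(?h, v) \<in> r" | g where "(?h, v) \<notin> r" "meet v ?h g" "E v (b x) = Some g"
      | "(?h, v) \<notin> r" "\<nexists>g. meet v ?h g" "E v (b x) = Some n"
      unfolding E_def by (metis someI_ex)
    then show ?thesis
    proof cases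
      case 1
      then show ?thesis using L'(4)[OF b(1)[OF that(1)]] by (simp add: E_def)
    next
      case 2
      then have g: "g < n" "\<And>u. (u, g) \<in> r \<longleftrightarrow> (u, v) \<in> r \<and> (u, ?h) \<in> r" by (auto simp: meet_def)
      then have "(g, v) \<in> r" "(g, ?h) \<in> r" using L'(2)[of g] by auto
      have "x \<in> X g" if xv: "(x, v) \<in> r"
      proof -
        have xg: "(x, g) \<in> r" using g xv b(1)[OF \<open>x < n\<close>] by blast
        have "b g = b x" using b_mono[OF xg] b_least[OF \<open>(g, ?h) \<in> r\<close>] by simp
        moreover from this have "g \<noteq> gs ! b g" using \<open>(g, v) \<in> r\<close> 2(1) by auto
        ultimately show ?thesis using small[OF g(1)] xg by simp
      qed
      moreover have "(x, v) \<in> r" if "x \<in> X g" using X_sub[OF that] g by blast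
      ultimately show ?thesis using 2 by auto
    next
      case 3
      have "(x, v) \<notin> r"
        using exists_meet[OF L, of x v ?h] b(1)[OF that(1)] 3(2) by (auto simp: meet_def)
      then show ?thesis using 3 Xn by simp
    qed
  qed
  moreover have "m \<le> n" if "E v i = Some m" for v i m
  proof -
    have "(SOME g. meet v (gs ! i) g) < n" if "meet v (gs ! i) g" for g
      using someI[of "meet v (gs ! i)", OF that] meet_def by blast
    with that show ?thesis by (auto simp: E_def split: if_splits intro: less_imp_le)
  qed
  moreover have "X m \<subseteq> {..<n} \<and> card (X m) \<le> q" for m
    using L'(3) by (auto simp: X_def)
  moreover have "Suc (length hs) \<le> q + 1" "\<forall>x<n. b x < Suc (length hs)"
    using \<open>length hs \<le> q\<close> b(2) by (auto simp: less_Suc_eq_le)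
  ultimately show ?thesis by blast
qed

subsection \<open>Decision trees\<close>

datatype 'a dtree = Leaf 'a | Node 'a "'a dtree" "'a dtree"

primrec depth :: "'a dtree \<Rightarrow> nat" where
  "depth (Leaf z) = 0"
| "depth (Node v yes no) = Suc (max (depth yes) (depth no))"

primrec leaves :: "'a dtree \<Rightarrow> nat" where
  "leaves (Leaf z) = 1"
| "leaves (Node v yes no) = leaves yes + leaves no"

primrec identifies :: "'a rel \<Rightarrow> 'a set \<Rightarrow> 'a dtree \<Rightarrow> bool" where
  "identifies r S (Leaf z) \<longleftrightarrow> S = {z}"
| "identifies r S (Node v yes no) \<longleftrightarrow>
     v \<in> S \<and> identifies r {x \<in> S. (x, v) \<in> r} yes \<and> identifies r {x \<in> S. (x, v) \<notin> r} no"

lemma leaves_identifies: "identifies r S T \<Longrightarrow> finite S \<Longrightarrow> leaves T = card S"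
proof (induction T arbitrary: S)
  case (Leaf z)
  then show ?case by simp
next
  case (Node v yes no)
  have "card {x \<in> S. (x, v) \<in> r} + card {x \<in> S. (x, v) \<notin> r} =
      card ({x \<in> S. (x, v) \<in> r} \<union> {x \<in> S. (x, v) \<notin> r})"
    using Node.prems by (intro card_Un_disjoint[symmetric]) auto
  also have "{x \<in> S. (x, v) \<in> r} \<union> {x \<in> S. (x, v) \<notin> r} = S" by blast
  finally show ?case
    using Node.prems Node.IH(1)[of "{x \<in> S. (x, v) \<in> r}"] Node.IH(2)[of "{x \<in> S. (x, v) \<notin> r}"] by simp
qed

lemma mult_log_le:
  assumes "2 \<le> (i :: nat)" "i \<le> d"
  shows "real i * log 2 (real d) \<le> 3 * real d * log 2 (real i)"
proof -
  have "log 2 (real d) = log 2 (real i) + log 2 (real d / real i)"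
    using assms by (simp add: log_divide)
  also have "log 2 (real d / real i) \<le> 2 * (real d / real i)"
  proof -
    have le: "y \<le> 2 * y * ln 2" if "0 \<le> y" for y :: real
      using mult_left_mono[of "1 / 2" "ln (2 :: real)" "2 * y"]
        ln_le_minus_one[of "1 / 2 :: real"] that by (simp add: ln_div)
    have "ln (real d / real i) \<le> real d / real i"
      using ln_le_minus_one[of "real d / real i"] assms by simp
    also have "\<dots> \<le> 2 * (real d / real i) * ln 2" by (rule le) simp
    finally have "ln (real d / real i) \<le> 2 * (real d / real i) * ln 2" .
    then show ?thesis by (simp add: log_def divide_le_eq)
  qed
  finally have "real i * log 2 (real d) \<le> real i * (log 2 (real i) + 2 * (real d / real i))"
    by (intro mult_left_mono) auto
  also have "\<dots> = real i * log 2 (real i) + 2 * real d * 1"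
    using assms by (simp add: field_simps)
  also have "\<dots> \<le> real d * log 2 (real i) + 2 * real d * log 2 (real i)"
    using assms by (intro add_mono mult_right_mono mult_left_mono) (auto simp: le_log_iff)
  finally show ?thesis by simp
qed

definition depth_const :: "nat \<Rightarrow> real" where
  "depth_const d = 5 * real d / log 2 (real d)"

lemma depth_const_step:
  assumes "2 \<le> d" "i \<le> d"
  shows "real (Suc i) \<le> depth_const d * log 2 (real (max 2 i))"
proof -
  have log: "0 < log 2 (real d)" using assms by simp
  have "real (Suc i) \<le> 5 / 3 * real (max 2 i)" by (auto simp: max_def)
  also have "\<dots> = 5 / 3 * (real (max 2 i) * log 2 (real d)) / log 2 (real d)"
    using log by simp
  also have "\<dots> \<le> 5 / 3 * (3 * real d * log 2 (real (max 2 i))) / log 2 (real d)"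
    using mult_log_le[of "max 2 i" d] assms
    by (intro divide_right_mono mult_left_mono) auto
  finally show ?thesis by (simp add: depth_const_def)
qed

lemma depth_const_ge_one:
  assumes "2 \<le> d"
  shows "1 \<le> depth_const d"
  using depth_const_step[OF assms, of 0] assms by simp

lemma depth_const_mult_log:
  assumes "2 \<le> d" "i \<le> d" "0 < s" "max 2 i * s \<le> N"
  shows "real (Suc i) + depth_const d * log 2 (real s) \<le> depth_const d * log 2 (real N)"
proof -
  have "real (Suc i) + depth_const d * log 2 (real s)
      \<le> depth_const d * (log 2 (real (max 2 i)) + log 2 (real s))"
    using depth_const_step[OF assms(1,2)] by (simp add: distrib_left)
  also have "log 2 (real (max 2 i)) + log 2 (real s) = log 2 (real (max 2 i * s))"
    using \<open>0 < s\<close> by (simp add: log_mult)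
  also have "depth_const d * \<dots> \<le> depth_const d * log 2 (real N)"
  proof (intro mult_left_mono)
    have "0 < max 2 i * s" using \<open>0 < s\<close> by simp
    then have "0 < real (max 2 i * s)" "real (max 2 i * s) \<le> real N"
      using assms(4) by (simp_all only: of_nat_0_less_iff of_nat_le_iff)
    then show "log 2 (real (max 2 i * s)) \<le> log 2 (real N)" by simp
    show "0 \<le> depth_const d" using depth_const_ge_one[OF assms(1)] by simp
  qed
  finally show ?thesis .
qed

text \<open>After \<open>i\<close> children have been refuted, a set \<open>S\<close> of candidates is left out of \<open>N\<close>. Since the
  children are tested by decreasing number of candidates, a child that is still untested has at
  most \<open>N / (i + 1)\<close> of them: this is what the invariant \<open>i |S \<inter> \<down>u| + |S| \<le> N\<close> yields.\<close>

lemma exists_tree_below_children: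
  assumes r: "finite A" "\<And>x. x \<in> A \<Longrightarrow> (x, x) \<in> r" "\<And>x y. (x, y) \<in> r \<Longrightarrow> x \<in> A \<and> y \<in> A"
    "\<And>x y z. (x, y) \<in> r \<Longrightarrow> (y, z) \<in> r \<Longrightarrow> (x, z) \<in> r"
    and sub: "\<And>u D. u \<in> A \<Longrightarrow> u \<notin> D \<Longrightarrow> (\<And>x y. (x, y) \<in> r \<Longrightarrow> y \<in> D \<Longrightarrow> x \<in> D) \<Longrightarrow>
       2 * card ({x. (x, u) \<in> r} - D) \<le> N \<Longrightarrow>
       \<exists>T. identifies r ({x. (x, u) \<in> r} - D) T \<and>
         real (depth T) \<le> depth_const d * log 2 (card ({x. (x, u) \<in> r} - D))"
    and "2 \<le> N" "2 \<le> d" "v \<in> A"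
    and "finite U" "v \<notin> D" "\<And>x y. (x, y) \<in> r \<Longrightarrow> y \<in> D \<Longrightarrow> x \<in> D"
    and "\<And>u. u \<in> U \<Longrightarrow> (u, v) \<in> r \<and> (v, u) \<notin> r"
    and "\<And>x. (x, v) \<in> r \<Longrightarrow> x \<noteq> v \<Longrightarrow> x \<notin> D \<Longrightarrow> \<exists>u\<in>U. (x, u) \<in> r"
    and "\<And>u. u \<in> U \<Longrightarrow> i * card ({x. (x, u) \<in> r} - D) + card ({x. (x, v) \<in> r} - D) \<le> N"
    and "\<And>u. u \<in> U \<Longrightarrow> 2 * card ({x. (x, u) \<in> r} - D) \<le> N"
    and "i + card U \<le> d" "i + card ({x. (x, v) \<in> r} - D) \<le> N"
  shows "\<exists>T. identifies r ({x. (x, v) \<in> r} - D) T \<and>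
    real (depth T) + real (Suc i) \<le> depth_const d * log 2 (real N)"
  using assms(9-)
proof (induction "card U" arbitrary: U D i)
  case (0 U D i)
  then have "{x. (x, v) \<in> r} - D = {v}" using r(2)[OF \<open>v \<in> A\<close>] by auto
  moreover from this have "max 2 i * 1 \<le> N" using 0 \<open>2 \<le> N\<close> by simp
  ultimately show ?case
    using depth_const_mult_log[of d i 1 N] 0 \<open>2 \<le> d\<close> by (intro exI[of _ "Leaf v"]) simp
next
  case (Suc k U D i)
  define S where "S = {x. (x, v) \<in> r} - D"
  define s where "s u = card ({x. (x, u) \<in> r} - D)" for u
  have fin: "finite {x. (x, u) \<in> r}" for u
    by (rule finite_subset[OF _ \<open>finite A\<close>]) (use r(3) in auto)
  have "v \<in> S" using Suc.prems r(2)[OF \<open>v \<in> A\<close>] by (simp add: S_def)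
  have leafcase: ?case if "S = {v}"
  proof -
    have "max 2 i * 1 \<le> N" "i \<le> d" using Suc.prems \<open>2 \<le> N\<close> that by (simp_all add: S_def)
    then show ?thesis
      using that depth_const_mult_log[of d i 1 N] \<open>2 \<le> d\<close>
      by (intro exI[of _ "Leaf v"]) (simp add: S_def)
  qed
  have "U \<noteq> {}" using Suc.hyps(2) by auto
  then have "Max (s ` U) \<in> s ` U" using Suc.prems(1) by (intro Max_in) auto
  then obtain u where "u \<in> U" and "s u = Max (s ` U)" by auto
  then have u_max: "s u' \<le> s u" if "u' \<in> U" for u'
    using that Suc.prems(1) by simp
  have u: "(u, v) \<in> r" "(v, u) \<notin> r" using Suc.prems(4)[OF \<open>u \<in> U\<close>] by auto
  then have "u \<in> A" using r(3) by blast
  show ?case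
  proof (cases "u \<in> D")
    case True
    then have "{x. (x, u) \<in> r} - D = {}" using Suc.prems(3) by blast
    then have "s u = 0" by (simp only: s_def card.empty)
    have "{x. (x, u') \<in> r} \<subseteq> D" if "u' \<in> U" for u'
    proof -
      have "card ({x. (x, u') \<in> r} - D) = 0" using u_max[OF that] \<open>s u = 0\<close> by (simp add: s_def)
      then show ?thesis using fin by (simp add: Diff_eq_empty_iff)
    qed
    then have "S = {v}" using Suc.prems(5) \<open>v \<in> S\<close> by (auto simp: S_def) 
    then show ?thesis by (rule leafcase)
  next
    case False
    then have "u \<in> {x. (x, u) \<in> r} - D" using r(2) \<open>u \<in> A\<close> by simp
    then have "0 < s u" using fin by (auto simp: s_def card_gt_0_iff)
    define D' where "D' = D \<union> {x. (x, u) \<in> r}"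
    have s_le: "i * s u + card S \<le> N" "2 * s u \<le> N"
      using Suc.prems \<open>u \<in> U\<close> by (simp_all add: s_def S_def)
    have S': "{x. (x, v) \<in> r} - D' = S - ({x. (x, u) \<in> r} - D)" by (auto simp: S_def D'_def)
    have subS: "{x. (x, u) \<in> r} - D \<subseteq> S" using u r(4) by (auto simp: S_def)
    then have cS: "card ({x. (x, v) \<in> r} - D') + s u = card S"
      using fin card_mono[of S "{x. (x, u) \<in> r} - D"]
      by (subst S') (simp add: card_Diff_subset s_def S_def)
    obtain T where T: "identifies r ({x. (x, u) \<in> r} - D) T"
      "real (depth T) \<le> depth_const d * log 2 (real (s u))"
      using sub[of u D] False \<open>u \<in> A\<close> Suc.prems(3) s_le(2) by (auto simp: s_def)
    have "Suc i \<le> d" using Suc.prems(8) Suc.hyps(2) by linarith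
    moreover have "max 2 (Suc i) * s u \<le> N"
    proof -
      have "s u \<le> card S" using cS by linarith
      then have "Suc i * s u \<le> N" using s_le by simp
      with s_le show ?thesis by (auto simp: max_def)
    qed
    ultimately have "real (Suc (Suc i)) + depth_const d * log 2 (real (s u))
        \<le> depth_const d * log 2 (real N)"
      using \<open>0 < s u\<close> \<open>2 \<le> d\<close> by (intro depth_const_mult_log)
    with T have T_depth: "real (depth T) + real (Suc (Suc i)) \<le> depth_const d * log 2 (real N)" by linarith
    have "\<exists>T'. identifies r ({x. (x, v) \<in> r} - D') T' \<and>
      real (depth T') + real (Suc (Suc i)) \<le> depth_const d * log 2 (real N)"
    proof (rule Suc.hyps(1)[of "U - {u}"])
      show "k = card (U - {u})" "finite (U - {u})"
        using Suc.hyps(2) Suc.prems(1) \<open>u \<in> U\<close> by simp_all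
      show "v \<notin> D'" using Suc.prems(2) u by (simp add: D'_def)
      show "\<And>x y. (x, y) \<in> r \<Longrightarrow> y \<in> D' \<Longrightarrow> x \<in> D'"
        using Suc.prems(3) r(4) unfolding D'_def by blast
      show "\<And>u'. u' \<in> U - {u} \<Longrightarrow> (u', v) \<in> r \<and> (v, u') \<notin> r" using Suc.prems(4) by blast
      show "\<And>x. (x, v) \<in> r \<Longrightarrow> x \<noteq> v \<Longrightarrow> x \<notin> D' \<Longrightarrow> \<exists>u'\<in>U - {u}. (x, u') \<in> r"
        using Suc.prems(5) unfolding D'_def by blast
      have le: "card ({x. (x, u') \<in> r} - D') \<le> s u'" for u'
        unfolding s_def by (rule card_mono) (auto simp: fin D'_def)
      show "2 * card ({x. (x, u') \<in> r} - D') \<le> N" if "u' \<in> U - {u}" for u'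
        using Suc.prems(7)[of u'] that le[of u'] by (simp add: s_def)
      show "Suc i * card ({x. (x, u') \<in> r} - D') + card ({x. (x, v) \<in> r} - D') \<le> N"
        if "u' \<in> U - {u}" for u'
      proof -
        have "card ({x. (x, u') \<in> r} - D') \<le> s u" using le[of u'] u_max[of u'] that by simp
        then have "Suc i * card ({x. (x, u') \<in> r} - D') \<le> Suc i * s u" by (rule mult_le_mono2)
        with cS s_le(1) show ?thesis by simp
      qed
      show "Suc i + card (U - {u}) \<le> d"
        using Suc.prems(8) Suc.prems(1) Suc.hyps(2) \<open>u \<in> U\<close> by simp
      show "Suc i + card ({x. (x, v) \<in> r} - D') \<le> N"
        using Suc.prems(9) cS \<open>0 < s u\<close> by (simp add: S_def)
    qed
    then obtain T' where T': "identifies r ({x. (x, v) \<in> r} - D') T'"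
      "real (depth T') + real (Suc (Suc i)) \<le> depth_const d * log 2 (real N)" by blast
    have "{x \<in> S. (x, u) \<in> r} = {x. (x, u) \<in> r} - D" using subS by (auto simp: S_def)
    moreover have "{x \<in> S. (x, u) \<notin> r} = {x. (x, v) \<in> r} - D'" by (auto simp: S_def D'_def)
    moreover have "u \<in> S" using False u by (simp add: S_def)
    ultimately have "identifies r S (Node u T T')" using T(1) T'(1) by simp
    moreover have "real (depth (Node u T T')) + real (Suc i) \<le> depth_const d * log 2 (real N)"
      using T_depth T'(2) by (simp add: max_def)
    ultimately show ?thesis unfolding S_def by blast
  qed
qed

lemma exists_cover:
  assumes L: "partial_lattice A r" and "less_in r x v"
  shows "\<exists>u. (u, v) \<in> transitive_reduction A r \<and> (x, u) \<in> r"
proof -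
  note L = partial_latticeD[OF L]
  define B where "B = {u. (x, u) \<in> r \<and> less_in r u v}"
  define u where "u = (ARG_MIN (\<lambda>u. card {w. (u, w) \<in> r}) u. u \<in> B)"
  have fin: "finite {w. (u, w) \<in> r}" for u
    by (rule finite_subset[OF _ L(1)]) (use L(3) in auto)
  have "x \<in> B" using assms(2) L(2,3) by (auto simp: B_def less_in_def)
  then have u: "u \<in> B" "\<And>w. w \<in> B \<Longrightarrow> card {w. (u, w) \<in> r} \<le> card {z. (w, z) \<in> r}"
    unfolding u_def by (auto intro: arg_min_natI arg_min_nat_le)
  have "\<not> (less_in r u w \<and> less_in r w v)" for w
  proof
    assume w: "less_in r u w \<and> less_in r w v"
    then have "w \<in> B" using u(1) L(4)[of x u w] by (auto simp: B_def less_in_def)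
    have "u \<notin> {z. (w, z) \<in> r}" "u \<in> {z. (u, z) \<in> r}" "{z. (w, z) \<in> r} \<subseteq> {z. (u, z) \<in> r}"
      using w L(2)[of u] L(3)[of u w] L(4)[of u w] L(5)[of u w] by (auto simp: less_in_def)
    then have "card {z. (w, z) \<in> r} < card {z. (u, z) \<in> r}"
      using fin by (intro psubset_card_mono) auto
    with u(2)[OF \<open>w \<in> B\<close>] show False by simp
  qed
  moreover have "(x, u) \<in> r" "less_in r u v" "u \<in> A" "v \<in> A"
    using u(1) L(3)[of u v] by (auto simp: B_def less_in_def)
  ultimately have "(u, v) \<in> transitive_reduction A r"
    unfolding transitive_reduction_def by blast
  with \<open>(x, u) \<in> r\<close> show ?thesis by blast
qed

lemma exists_tree:
  assumes L: "partial_lattice A r" and "2 \<le> d" and deg: "\<And>v. v \<in> A \<Longrightarrow> degree A r v \<le> d"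
    and "t \<in> A" "t \<notin> D" "\<And>x y. (x, y) \<in> r \<Longrightarrow> y \<in> D \<Longrightarrow> x \<in> D"
  shows "\<exists>T. identifies r ({x. (x, t) \<in> r} - D) T \<and>
    real (depth T) \<le> depth_const d * log 2 (card ({x. (x, t) \<in> r} - D))"
  using assms(4-)
proof (induction "card ({x. (x, t) \<in> r} - D)" arbitrary: t D rule: less_induct)
  case (less t D)
  note L' = partial_latticeD[OF L]
  define S where "S = {x. (x, t) \<in> r} - D"
  define s where "s v = card ({x. (x, v) \<in> r} - D)" for v
  define N where "N = card S"
  have fin: "finite {x. (x, u) \<in> r}" for u
    by (rule finite_subset[OF _ L'(1)]) (use L'(3) in auto)
  have "t \<in> S" using less.prems L'(2) by (simp add: S_def)
  have "finite S" using fin by (simp add: S_def)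
  show ?case
  proof (cases "S = {t}")
    case True
    then show ?thesis by (intro exI[of _ "Leaf t"]) (simp add: S_def)
  next
    case False
    then have "{t} \<subset> S" using \<open>t \<in> S\<close> by blast
    then have "2 \<le> N" using psubset_card_mono[OF \<open>finite S\<close>, of "{t}"] by (simp add: N_def)
    define v where "v = (ARG_MIN s v. v \<in> S \<and> N < 2 * s v)"
    have "N < 2 * s t" using \<open>2 \<le> N\<close> by (simp add: s_def N_def S_def)
    then have v: "v \<in> S" "N < 2 * s v" "\<And>u. u \<in> S \<Longrightarrow> N < 2 * s u \<Longrightarrow> s v \<le> s u"
      using arg_min_natI[of "\<lambda>v. v \<in> S \<and> N < 2 * s v" t s]
        arg_min_nat_le[of "\<lambda>v. v \<in> S \<and> N < 2 * s v" _ s] \<open>t \<in> S\<close>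
      unfolding v_def by auto
    then have vr: "v \<in> A" "(v, t) \<in> r" "v \<notin> D" using L'(3) by (auto simp: S_def)
    have subS: "{x. (x, v) \<in> r} - D \<subseteq> S" using vr L'(4) by (auto simp: S_def)
    then have "s v \<le> N" using \<open>finite S\<close> by (simp add: s_def N_def card_mono)
    define U where "U = {u. (u, v) \<in> transitive_reduction A r}"
    have U: "(u, v) \<in> r \<and> (v, u) \<notin> r" if "u \<in> U" for u
      using that L'(5) by (auto simp: U_def transitive_reduction_def less_in_def)
    have small: "2 * s u \<le> N" if "u \<in> U" for u
    proof (rule ccontr)
      assume "\<not> 2 * s u \<le> N"
      have "{x. (x, u) \<in> r} - D \<noteq> {}"
      proof
        assume "{x. (x, u) \<in> r} - D = {}"
        then have "s u = 0" by (simp only: s_def card.empty)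
        with \<open>\<not> 2 * s u \<le> N\<close> show False by simp
      qed
      then have "u \<in> S" using less.prems(3) U[OF that] subS by blast
      have "v \<in> {x. (x, v) \<in> r} - D" "v \<notin> {x. (x, u) \<in> r} - D"
        "{x. (x, u) \<in> r} - D \<subseteq> {x. (x, v) \<in> r} - D"
        using U[OF that] vr L'(2,4) by auto
      then have "s u < s v" unfolding s_def using fin by (intro psubset_card_mono) auto
      with v(3)[OF \<open>u \<in> S\<close>] \<open>\<not> 2 * s u \<le> N\<close> show False by simp
    qed
    have "\<exists>T. identifies r ({x. (x, v) \<in> r} - D) T \<and>
      real (depth T) + real (Suc 0) \<le> depth_const d * log 2 (real N)"
    proof (rule exists_tree_below_children[where U = U and i = 0 and A = A])
      show "finite U" by (rule finite_subset[OF _ L'(1)]) (auto simp: U_def transitive_reduction_def)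
      show "\<exists>u\<in>U. (x, u) \<in> r" if "(x, v) \<in> r" "x \<noteq> v" "x \<notin> D" for x
        using exists_cover[OF L, of x v] that by (auto simp: U_def less_in_def)
      show "0 + card U \<le> d" using deg[OF vr(1)] by (simp add: degree_def U_def)
      show "\<exists>T. identifies r ({x. (x, u) \<in> r} - E) T \<and>
         real (depth T) \<le> depth_const d * log 2 (card ({x. (x, u) \<in> r} - E))"
        if "u \<in> A" "u \<notin> E" "\<And>x y. (x, y) \<in> r \<Longrightarrow> y \<in> E \<Longrightarrow> x \<in> E"
          "2 * card ({x. (x, u) \<in> r} - E) \<le> N" for u E
        using that \<open>2 \<le> N\<close> by (intro less.hyps) (auto simp: N_def S_def)
      show "\<And>u. u \<in> U \<Longrightarrow> (u, v) \<in> r \<and> (v, u) \<notin> r" by (rule U)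
      show "2 * card ({x. (x, u) \<in> r} - D) \<le> N" if "u \<in> U" for u
        using small[OF that] by (simp add: s_def)
      show "0 * card ({x. (x, u) \<in> r} - D) + card ({x. (x, v) \<in> r} - D) \<le> N" for u
        using \<open>s v \<le> N\<close> by (simp add: s_def)
      show "0 + card ({x. (x, v) \<in> r} - D) \<le> N"
        using \<open>s v \<le> N\<close> by (simp add: s_def)
      show "\<And>x y. (x, y) \<in> r \<Longrightarrow> y \<in> D \<Longrightarrow> x \<in> D" by (rule less.prems(3))
    qed (fact L'(1-4) vr \<open>2 \<le> N\<close> \<open>2 \<le> d\<close>)+
    then obtain T where T: "identifies r ({x. (x, v) \<in> r} - D) T"
      "real (depth T) + 1 \<le> depth_const d * log 2 (real N)" by auto
    show ?thesis
    proof (cases "v = t")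
      case True
      then show ?thesis using T by (auto simp: N_def S_def intro!: exI[of _ T])
    next
      case False
      define D' where "D' = D \<union> {x. (x, v) \<in> r}"
      define N' where "N' = card ({x. (x, t) \<in> r} - D')"
      have "t \<notin> D'" using less.prems False vr L'(5) by (auto simp: D'_def)
      have D': "\<And>x y. (x, y) \<in> r \<Longrightarrow> y \<in> D' \<Longrightarrow> x \<in> D'"
        using less.prems(3) L'(4) unfolding D'_def by blast
      have "{x. (x, t) \<in> r} - D' = S - ({x. (x, v) \<in> r} - D)" by (auto simp: S_def D'_def)
      then have "N' + s v = N" using subS \<open>finite S\<close> \<open>s v \<le> N\<close> finite_subset[OF subS]
        by (simp add: N'_def N_def s_def card_Diff_subset)
      with v(2) have "2 * N' < N" by simp
      moreover have "0 < N'" using \<open>t \<notin> D'\<close> L'(2)[OF less.prems(1)] fin by (auto simp: N'_def card_gt_0_iff)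
      ultimately have N': "real (Suc 0) + depth_const d * log 2 (real N') \<le> depth_const d * log 2 (real N)"
        using \<open>2 \<le> d\<close> by (intro depth_const_mult_log) auto
      have "\<exists>T'. identifies r ({x. (x, t) \<in> r} - D') T' \<and>
          real (depth T') \<le> depth_const d * log 2 (real N')"
        unfolding N'_def
      proof (rule less.hyps)
        show "card ({x. (x, t) \<in> r} - D') < card ({x. (x, t) \<in> r} - D)"
          using \<open>2 * N' < N\<close> by (simp add: N'_def N_def S_def)
      qed (fact less.prems(1) \<open>t \<notin> D'\<close> D')+
      then obtain T' where T': "identifies r ({x. (x, t) \<in> r} - D') T'"
        "real (depth T') \<le> depth_const d * log 2 (real N')" by blast
      have "{x \<in> S. (x, v) \<in> r} = {x. (x, v) \<in> r} - D" using subS by (auto simp: S_def)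
      moreover have "{x \<in> S. (x, v) \<notin> r} = {x. (x, t) \<in> r} - D'" by (auto simp: S_def D'_def)
      ultimately have "identifies r S (Node v T T')" using T(1) T'(1) v(1) by simp
      moreover have "real (depth (Node v T T')) \<le> depth_const d * log 2 (real N)"
        using T(2) T'(2) N' by (simp add: max_def)
      ultimately show ?thesis unfolding S_def N_def by blast
    qed
  qed
qed

lemma set_dtree_identifies: "identifies r S T \<Longrightarrow> set_dtree T \<subseteq> S"
proof (induction T arbitrary: S)
  case (Node v yes no)
  have "set_dtree yes \<subseteq> {x \<in> S. (x, v) \<in> r}" "set_dtree no \<subseteq> {x \<in> S. (x, v) \<notin> r}"
    using Node.prems by (simp_all only: identifies.simps Node.IH)
  with Node.prems show ?case by auto
qed simp

primrec search :: "('a \<Rightarrow> bool) \<Rightarrow> 'a dtree \<Rightarrow> 'a" where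
  "search f (Leaf z) = z"
| "search f (Node v yes no) = (if f v then search f yes else search f no)"

lemma search_identifies:
  assumes "identifies r S T" "z \<in> S" "\<And>v. v \<in> set_dtree T \<Longrightarrow> f v \<longleftrightarrow> (z, v) \<in> r"
  shows "search f T = z"
  using assms
proof (induction T arbitrary: S)
  case (Node v yes no)
  then show ?case
    using Node.IH(1)[of "{x \<in> S. (x, v) \<in> r}"] Node.IH(2)[of "{x \<in> S. (x, v) \<notin> r}"] by simp
qed simp

subsection \<open>The query program\<close>

lemma run_numeral: "run w P (numeral k) c = Option.bind (step w P c) (run w P (pred_numeral k))"
  by (simp add: numeral_eq_Suc)

lemma run_add: "run w P s c = Some c' \<Longrightarrow> run w P (s + t) c = run w P t c'"
proof (induction s arbitrary: c)
  case 0
  then show ?case by simp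
next
  case (Suc s)
  then obtain c1 where "step w P c = Some c1" "run w P s c1 = Some c'"
    by (auto simp: Option.bind_eq_Some_conv simp del: step.simps)
  then show ?case using Suc.IH by (simp del: step.simps)
qed

definition order_test :: "nat list \<Rightarrow> nat \<Rightarrow> nat \<Rightarrow> nat \<Rightarrow> nat \<Rightarrow> bool" where
  "order_test M a i j x \<longleftrightarrow> M ! a = 0 \<or> M ! (M ! (M ! (M ! a + j) + i) + j) = x"

definition order_safe :: "nat list \<Rightarrow> nat \<Rightarrow> nat \<Rightarrow> nat \<Rightarrow> bool" where
  "order_safe M a i j \<longleftrightarrow> a < length M \<and> (M ! a \<noteq> 0 \<longrightarrow> M ! a + j < length M \<and>
     M ! (M ! a + j) + i < length M \<and> M ! (M ! (M ! a + j) + i) + j < length M)"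

definition order_code :: "reg \<Rightarrow> reg \<Rightarrow> reg \<Rightarrow> reg \<Rightarrow> label \<Rightarrow> program" where
  "order_code b i j x l =
    [Op Add 15 13 b, Load 15 15, JumpEq 15 11 l,
     Op Add 15 15 j, Load 15 15, Op Add 15 15 i, Load 15 15, Op Add 15 15 j, Load 15 15,
     JumpEq 15 x l]"

lemma run_order_code:
  assumes P: "\<And>m. m < 10 \<Longrightarrow> P ! (k + m) = order_code b i j x l ! m" "k + 10 \<le> length P"
    and regs: "15 \<notin> {b, i, j, x}" "R 11 = 0"
    and safe: "order_safe M (R 13 + R b) (R i) (R j)" and len: "length M \<le> 2 ^ w"
  shows "\<exists>t\<le>10. \<exists>c. run w P t (k, R, M) =
    Some (if order_test M (R 13 + R b) (R i) (R j) (R x) then l else k + 10, R(15 := c), M)"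
proof -
  have Pn: "P ! k = Op Add 15 13 b" "P ! (k + 1) = Load 15 15" "P ! (k + 2) = JumpEq 15 11 l"
    "P ! (k + 3) = Op Add 15 15 j" "P ! (k + 4) = Load 15 15" "P ! (k + 5) = Op Add 15 15 i"
    "P ! (k + 6) = Load 15 15" "P ! (k + 7) = Op Add 15 15 j" "P ! (k + 8) = Load 15 15"
    "P ! (k + 9) = JumpEq 15 x l"
    using P(1)[of 0] P(1)[of 1] P(1)[of 2] P(1)[of 3] P(1)[of 4] P(1)[of 5] P(1)[of 6] P(1)[of 7]
      P(1)[of 8] P(1)[of 9] by (simp_all add: order_code_def)
  define a where "a = R 13 + R b"
  have a: "a < length M" "a < 2 ^ w" using safe len by (auto simp: order_safe_def a_def)
  have 1: "run w P 2 (k, R, M) = Some (k + 2, R(15 := M ! a), M)"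
    using Pn P(2) a a_def regs by (simp add: numeral_2_eq_2)
  show ?thesis
  proof (cases "M ! a = 0")
    case True
    have "run w P (2 + 1) (k, R, M) = Some (l, R(15 := 0), M)"
      unfolding run_add[OF 1] using Pn P(2) True regs by simp
    then show ?thesis using True by (intro exI[of _ "2 + 1"]) (auto simp: order_test_def a_def)
  next
    case False
    define a1 where "a1 = M ! a + R j"
    define a2 where "a2 = M ! a1 + R i"
    define a3 where "a3 = M ! a2 + R j"
    have s: "a1 < length M" "a2 < length M" "a3 < length M"
      using safe False by (auto simp: order_safe_def a_def a1_def a2_def a3_def)
    then have s2: "a1 < 2 ^ w" "a2 < 2 ^ w" "a3 < 2 ^ w" using len by auto
    have 2: "run w P (2 + 1) (k, R, M) = Some (k + 3, R(15 := M ! a), M)"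
      unfolding run_add[OF 1] using Pn P(2) False regs by simp
    have 3: "run w P (2 + 1 + 2) (k, R, M) = Some (k + 5, R(15 := M ! a1), M)"
      unfolding run_add[OF 2] using Pn P(2) s(1) s2(1) regs a1_def
      by (simp add: numeral_2_eq_2 add.commute[of _ k])
    have 4: "run w P (2 + 1 + 2 + 2) (k, R, M) = Some (k + 7, R(15 := M ! a2), M)"
      unfolding run_add[OF 3] using Pn P(2) s(2) s2(2) regs a2_def
      by (simp add: numeral_2_eq_2 add.commute[of _ k])
    have 5: "run w P (2 + 1 + 2 + 2 + 2) (k, R, M) = Some (k + 9, R(15 := M ! a3), M)"
      unfolding run_add[OF 4] using Pn P(2) s(3) s2(3) regs a3_def
      by (simp add: numeral_2_eq_2 add.commute[of _ k])
    have "run w P (2 + 1 + 2 + 2 + 2 + 1) (k, R, M) =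
        Some (if M ! a3 = R x then l else k + 10, R(15 := M ! a3), M)"
      unfolding run_add[OF 5] using Pn P(2) regs by simp
    moreover have "order_test M (R 13 + R b) (R i) (R j) (R x) \<longleftrightarrow> M ! a3 = R x"
      using False by (simp add: order_test_def a_def a1_def a2_def a3_def)
    ultimately show ?thesis by (intro exI[of _ "2 + 1 + 2 + 2 + 2 + 1"]) auto
  qed
qed

text \<open>Memory starts with the address of the decision tree, the number \<open>q\<close>, and the table of block
  numbers. Registers 9, 5, 4 hold the block number of \<open>x\<close>, \<open>x div q\<close> and \<open>x mod q\<close>; registers
  10, 7, 6 hold the same for \<open>y\<close>; register 12 holds the current node of the decision tree.\<close>

definition join_prog :: program where
  "join_prog =
    [Const 2 1, Load 3 2, Op Mod 4 0 3, Op Div 5 0 3, Op Mod 6 1 3, Op Div 7 1 3,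
     Const 8 2, Op Add 9 0 8, Load 9 9, Op Add 10 1 8, Load 10 10, Const 11 0, Load 12 11,
     Load 13 12, Op Add 14 12 2, Load 14 14, JumpEq 14 11 42] @
    order_code 9 5 4 0 28 @ [Jump 38] @ order_code 10 7 6 1 40 @
    [Move 12 14, Jump 13, Op Add 12 12 8, Jump 13, Move 0 13, Halt]"

lemma length_join_prog: "length join_prog = 44"
  by (simp add: join_prog_def order_code_def)

lemma join_prog_nth:
  "join_prog ! 0 = Const 2 1" "join_prog ! Suc 0 = Load 3 2" "join_prog ! 2 = Op Mod 4 0 3"
  "join_prog ! 3 = Op Div 5 0 3" "join_prog ! 4 = Op Mod 6 1 3" "join_prog ! 5 = Op Div 7 1 3"
  "join_prog ! 6 = Const 8 2" "join_prog ! 7 = Op Add 9 0 8" "join_prog ! 8 = Load 9 9"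
  "join_prog ! 9 = Op Add 10 1 8" "join_prog ! 10 = Load 10 10" "join_prog ! 11 = Const 11 0"
  "join_prog ! 12 = Load 12 11" "join_prog ! 13 = Load 13 12" "join_prog ! 14 = Op Add 14 12 2"
  "join_prog ! 15 = Load 14 14" "join_prog ! 16 = JumpEq 14 11 42" "join_prog ! 27 = Jump 38"
  "join_prog ! 38 = Move 12 14" "join_prog ! 39 = Jump 13" "join_prog ! 40 = Op Add 12 12 8"
  "join_prog ! 41 = Jump 13" "join_prog ! 42 = Move 0 13" "join_prog ! 43 = Halt"
  by (simp_all add: join_prog_def order_code_def)

lemma join_prog_test:
  assumes "m < 10"
  shows "join_prog ! (17 + m) = order_code 9 5 4 0 28 ! m"
    "join_prog ! (28 + m) = order_code 10 7 6 1 40 ! m"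
proof -
  have "length (order_code b i j x l) = 10" for b i j x l by (simp add: order_code_def)
  then show "join_prog ! (17 + m) = order_code 9 5 4 0 28 ! m"
    "join_prog ! (28 + m) = order_code 10 7 6 1 40 ! m"
    using assms by (simp_all add: join_prog_def nth_append)
qed

primrec stored :: "nat list \<Rightarrow> (nat \<Rightarrow> nat) \<Rightarrow> nat \<Rightarrow> nat dtree \<Rightarrow> bool" where
  "stored M f p (Leaf z) \<longleftrightarrow> p + 1 < length M \<and> M ! p = z \<and> M ! (p + 1) = 0"
| "stored M f p (Node v yes no) \<longleftrightarrow> p + 2 < length M \<and> M ! p = f v \<and> M ! (p + 1) \<noteq> 0 \<and>
     stored M f (p + 2) yes \<and> stored M f (M ! (p + 1)) no"

lemma run_search:
  assumes "stored M f p T" "length M \<le> 2 ^ w"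
    and "R 0 = x" "R 1 = y" "R 2 = 1" "R 4 = jx" "R 5 = ix" "R 6 = jy" "R 7 = iy" "R 8 = 2"
      "R 9 = bx" "R 10 = by'" "R 11 = 0" "R 12 = p"
    and "\<And>v. v \<in> set_dtree T \<Longrightarrow> order_safe M (f v + bx) ix jx \<and> order_safe M (f v + by') iy jy"
  shows "\<exists>t\<le>27 * depth T + 5. \<exists>R'. run w join_prog t (13, R, M) = Some (43, R', M) \<and>
    R' 0 = search (\<lambda>v. order_test M (f v + bx) ix jx x \<and> order_test M (f v + by') iy jy y) T"
  using assms
proof (induction T arbitrary: p R)
  case (Leaf z)
  then have "run w join_prog 5 (13, R, M) =
      Some (43, R(13 := z, 14 := 0, 0 := z), M)"
    by (simp add: run_numeral join_prog_nth length_join_prog)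
  then show ?case by (intro exI[of _ 5]) auto
next
  case (Node v yes no)
  let ?A = "order_test M (f v + bx) ix jx x" and ?B = "order_test M (f v + by') iy jy y"
  let ?s = "search (\<lambda>v. order_test M (f v + bx) ix jx x \<and> order_test M (f v + by') iy jy y)"
  define p' where "p' = M ! (p + 1)"
  define R1 where "R1 = R(13 := f v, 14 := p')"
  have st: "p + 2 < length M" "M ! p = f v" "p' \<noteq> 0" "stored M f (p + 2) yes" "stored M f p' no"
    using Node.prems(1) by (simp_all add: p'_def)
  note len = Node.prems(2)
  note regs = Node.prems(3-14)
  have p: "p < length M" "p + 1 < length M" "p + 1 < 2 ^ w" "p + 2 < 2 ^ w"
    using st len by auto
  have 1: "run w join_prog 4 (13, R, M) = Some (17, R1, M)"
    using st p regs
    by (simp add: run_numeral numeral_2_eq_2[symmetric] join_prog_nth length_join_prog R1_def p'_def)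
  obtain t1 c1 where t1: "t1 \<le> 10" "run w join_prog t1 (17, R1, M) =
      Some (if ?A then 28 else 27, R1(15 := c1), M)"
    using run_order_code[of join_prog 17 9 5 4 0 28 R1 M w, OF join_prog_test(1)]
      length_join_prog regs len Node.prems(15)[of v] by (auto simp: R1_def)
  obtain t2 c2 where t2: "t2 \<le> 10" "run w join_prog t2 (28, R1(15 := c1), M) =
      Some (if ?B then 40 else 38, R1(15 := c2), M)"
    using run_order_code[of join_prog 28 10 7 6 1 40 "R1(15 := c1)" M w, OF join_prog_test(2)]
      length_join_prog regs len Node.prems(15)[of v] by (auto simp: R1_def)
  have yes: "run w join_prog 2 (40, R1(15 := c), M) = Some (13, R1(15 := c, 12 := p + 2), M)" for c
    using p regs by (simp add: run_numeral join_prog_nth length_join_prog R1_def)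
  have no: "run w join_prog 2 (38, R1(15 := c), M) = Some (13, R1(15 := c, 12 := p'), M)" for c
    using regs by (simp add: run_numeral join_prog_nth length_join_prog R1_def)
  have jump: "run w join_prog 1 (27, R1(15 := c), M) = Some (38, R1(15 := c), M)" for c
    by (simp add: join_prog_nth length_join_prog)
  have "\<exists>t\<le>27. \<exists>c. run w join_prog t (13, R, M) =
      Some (13, R1(15 := c, 12 := if ?A \<and> ?B then p + 2 else p'), M)"
  proof (cases ?A)
    case A: True
    have 2: "run w join_prog (4 + t1) (13, R, M) = Some (28, R1(15 := c1), M)"
      unfolding run_add[OF 1] using t1 A by simp
    have 3: "run w join_prog (4 + t1 + t2) (13, R, M) =
        Some (if ?B then 40 else 38, R1(15 := c2), M)"
      unfolding run_add[OF 2] by (rule t2)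
    have "run w join_prog (4 + t1 + t2 + 2) (13, R, M) =
        Some (13, R1(15 := c2, 12 := if ?B then p + 2 else p'), M)"
      unfolding run_add[OF 3] using yes no by simp
    moreover have "4 + t1 + t2 + 2 \<le> 27" using t1 t2 by simp
    ultimately show ?thesis using A by (intro exI[of _ "4 + t1 + t2 + 2"] conjI exI[of _ c2]) simp_all
  next
    case A: False
    have 2: "run w join_prog (4 + t1) (13, R, M) = Some (27, R1(15 := c1), M)"
      unfolding run_add[OF 1] using t1 A by simp
    have 3: "run w join_prog (4 + t1 + 1) (13, R, M) = Some (38, R1(15 := c1), M)"
      unfolding run_add[OF 2] by (rule jump)
    have "run w join_prog (4 + t1 + 1 + 2) (13, R, M) = Some (13, R1(15 := c1, 12 := p'), M)"
      unfolding run_add[OF 3] by (rule no)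
    moreover have "4 + t1 + 1 + 2 \<le> 27" using t1 by simp
    ultimately show ?thesis using A by (intro exI[of _ "4 + t1 + 1 + 2"] conjI exI[of _ c1]) simp_all
  qed
  then obtain t c where t: "t \<le> 27" "run w join_prog t (13, R, M) =
      Some (13, R1(15 := c, 12 := if ?A \<and> ?B then p + 2 else p'), M)" by blast
  let ?R = "R1(15 := c, 12 := if ?A \<and> ?B then p + 2 else p')"
  have "\<exists>t'\<le>27 * max (depth yes) (depth no) + 5. \<exists>R'. run w join_prog t' (13, ?R, M) = Some (43, R', M) \<and>
      R' 0 = ?s (Node v yes no)"
  proof (cases "?A \<and> ?B")
    case True
    have "\<exists>t'\<le>27 * depth yes + 5. \<exists>R'. run w join_prog t' (13, ?R, M) = Some (43, R', M) \<and> R' 0 = ?s yes"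
      by (rule Node.IH(1)[of "p + 2"]) (use True st len regs Node.prems(15) in \<open>auto simp: R1_def\<close>)
    then obtain t' R' where "t' \<le> 27 * depth yes + 5" "run w join_prog t' (13, ?R, M) = Some (43, R', M)"
      "R' 0 = ?s yes" by blast
    then show ?thesis using True by (intro exI[of _ t'] conjI exI[of _ R']) auto
  next
    case False
    have "\<exists>t'\<le>27 * depth no + 5. \<exists>R'. run w join_prog t' (13, ?R, M) = Some (43, R', M) \<and> R' 0 = ?s no"
      by (rule Node.IH(2)[of p']) (use False st len regs Node.prems(15) in \<open>auto simp: R1_def\<close>)
    then obtain t' R' where "t' \<le> 27 * depth no + 5" "run w join_prog t' (13, ?R, M) = Some (43, R', M)"
      "R' 0 = ?s no" by blast
    then show ?thesis using False by (intro exI[of _ t'] conjI exI[of _ R']) auto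
  qed
  then obtain t' R' where t': "t' \<le> 27 * max (depth yes) (depth no) + 5"
    "run w join_prog t' (13, ?R, M) = Some (43, R', M)" "R' 0 = ?s (Node v yes no)" by blast
  have "run w join_prog (t + t') (13, R, M) = Some (43, R', M)"
    unfolding run_add[OF t(2)] by (rule t'(2))
  moreover have "t + t' \<le> 27 * depth (Node v yes no) + 5" using t(1) t'(1) by simp
  ultimately show ?case using t'(3) by blast
qed

lemma run_prologue:
  assumes "R 0 = x" "R 1 = y" "1 < length M" "1 mod 2 ^ w = (1 :: nat)"
  shows "run w join_prog 6 (0, R, M) = Some (6, R(2 := 1, 3 := M ! 1, 4 := x mod M ! 1,
    5 := x div M ! 1, 6 := y mod M ! 1, 7 := y div M ! 1), M)"
proof -
  have 1: "run w join_prog 2 (0, R, M) = Some (2, R(2 := 1, 3 := M ! 1), M)"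
    using assms(3,4) by (simp add: run_numeral numeral_2_eq_2[symmetric] join_prog_nth length_join_prog)
  have "run w join_prog (2 + 4) (0, R, M) = Some (6, R(2 := 1, 3 := M ! 1, 4 := x mod M ! 1,
    5 := x div M ! 1, 6 := y mod M ! 1, 7 := y div M ! 1), M)"
    unfolding run_add[OF 1]
    using assms(1,2) by (simp add: run_numeral join_prog_nth length_join_prog)
  then show ?thesis by simp
qed

lemma run_prologue2:
  assumes "R 0 = x" "R 1 = y" "x + 2 < length M" "y + 2 < length M" "length M \<le> 2 ^ w"
    "2 mod 2 ^ w = (2 :: nat)"
  shows "run w join_prog 7 (6, R, M) =
    Some (13, R(8 := 2, 9 := M ! (x + 2), 10 := M ! (y + 2), 11 := 0, 12 := M ! 0), M)"
proof -
  have "M \<noteq> []" using assms(3) by auto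
  have x: "(x + 2) mod 2 ^ w = x + 2" "(y + 2) mod 2 ^ w = y + 2"
    by (rule mod_less, use assms(3-5) in linarith)+
  have 1: "run w join_prog 3 (6, R, M) = Some (9, R(8 := 2, 9 := M ! (x + 2)), M)"
    using assms(1-3,6) x by (simp add: run_numeral join_prog_nth length_join_prog)
  have "run w join_prog (3 + 4) (6, R, M) =
    Some (13, R(8 := 2, 9 := M ! (x + 2), 10 := M ! (y + 2), 11 := 0, 12 := M ! 0), M)"
    unfolding run_add[OF 1] using assms(1,2,4) x \<open>M \<noteq> []\<close>
    by (simp add: run_numeral join_prog_nth length_join_prog)
  then show ?thesis by simp
qed

lemma answers_join_prog:
  assumes "stored M f (M ! 0) T" "length M \<le> 2 ^ w" "2 \<le> w" "x + 2 < length M" "y + 2 < length M"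
    and q: "q = M ! 1" and b: "bx = M ! (x + 2)" "by' = M ! (y + 2)"
    and safe: "\<And>v. v \<in> set_dtree T \<Longrightarrow> order_safe M (f v + bx) (x div q) (x mod q) \<and>
      order_safe M (f v + by') (y div q) (y mod q)"
  shows "\<exists>t\<le>27 * depth T + 18. answers w join_prog M x y t
    (search (\<lambda>v. order_test M (f v + bx) (x div q) (x mod q) x \<and>
       order_test M (f v + by') (y div q) (y mod q) y) T)"
proof -
  have "(2 :: nat) ^ 2 \<le> 2 ^ w" by (rule power_increasing) (use \<open>2 \<le> w\<close> in simp_all)
  then have w4: "4 \<le> (2 :: nat) ^ w" by simp
  have w: "1 mod 2 ^ w = (1 :: nat)" "2 mod 2 ^ w = (2 :: nat)"
    by (rule mod_less, use w4 in linarith)+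
  define R0 where "R0 = (init_regs x y)(2 := 1, 3 := M ! 1, 4 := x mod M ! 1, 5 := x div M ! 1,
    6 := y mod M ! 1, 7 := y div M ! 1)"
  define R where "R = R0(8 := 2, 9 := bx, 10 := by', 11 := 0, 12 := M ! 0)"
  have 1: "run w join_prog 6 (0, init_regs x y, M) = Some (6, R0, M)"
    unfolding R0_def by (rule run_prologue) (use assms(4) w in \<open>simp_all add: init_regs_def\<close>)
  have 2: "run w join_prog 7 (6, R0, M) = Some (13, R, M)"
    unfolding R_def b by (rule run_prologue2) (use assms(2,4,5) w in \<open>simp_all add: init_regs_def R0_def\<close>)
  have 3: "run w join_prog (6 + 7) (0, init_regs x y, M) = Some (13, R, M)"
    unfolding run_add[OF 1] by (rule 2)
  obtain t R' where t: "t \<le> 27 * depth T + 5" "run w join_prog t (13, R, M) = Some (43, R', M)"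
    "R' 0 = search (\<lambda>v. order_test M (f v + bx) (x div q) (x mod q) x \<and>
       order_test M (f v + by') (y div q) (y mod q) y) T"
    using run_search[OF assms(1,2), of R x y "x mod q" "x div q" "y mod q" "y div q" bx by'] safe
    by (auto simp: R_def R0_def init_regs_def q)
  have "run w join_prog (6 + 7 + t) (0, init_regs x y, M) = Some (43, R', M)"
    unfolding run_add[OF 3] by (rule t(2))
  then have "answers w join_prog M x y (6 + 7 + t) (R' 0)"
    by (auto simp: answers_def join_prog_nth length_join_prog)
  then show ?thesis using t by (intro exI[of _ "6 + 7 + t"]) simp
qed

subsection \<open>Memory layout\<close>

primrec encode :: "(nat \<Rightarrow> nat) \<Rightarrow> nat \<Rightarrow> nat dtree \<Rightarrow> nat list" where
  "encode f p (Leaf z) = [z, 0]"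
| "encode f p (Node v yes no) =
     (let xs = encode f (p + 2) yes; p' = p + 2 + length xs in [f v, p'] @ xs @ encode f p' no)"

lemma length_encode: "length (encode f p T) + 2 = 4 * leaves T"
proof (induction T arbitrary: p)
  case (Leaf z)
  then show ?case by simp
next
  case (Node v yes no)
  let ?q = "p + 2 + length (encode f (p + 2) yes)"
  show ?case using Node.IH(1)[of "p + 2"] Node.IH(2)[of ?q] by (simp add: Let_def)
qed

lemma stored_encode: "stored (xs @ encode f (length xs) T @ ys) f (length xs) T"
proof (induction T arbitrary: xs ys)
  case (Leaf z)
  then show ?case by (simp add: nth_append)
next
  case (Node v yes no)
  define A where "A = encode f (length xs + 2) yes"
  define p' where "p' = length xs + 2 + length A"
  define B where "B = encode f p' no"
  let ?M = "xs @ [f v, p'] @ A @ B @ ys"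
  have "stored ?M f (length xs + 2) yes"
    using Node.IH(1)[of "xs @ [f v, p']" "B @ ys"] by (simp add: A_def)
  moreover have "stored ?M f p' no"
    using Node.IH(2)[of "xs @ [f v, p'] @ A" ys] by (simp add: B_def p'_def)
  moreover have "encode f (length xs) (Node v yes no) = [f v, p'] @ A @ B"
    by (simp add: A_def B_def p'_def Let_def)
  moreover have "B \<noteq> []" using length_encode[of f p' no] by (cases no) (auto simp: B_def Let_def)
  ultimately show ?case by (simp add: nth_append p'_def)
qed

lemma encode_le:
  assumes "p + length (encode f p T) \<le> b" "\<And>v. v \<in> set_dtree T \<Longrightarrow> v \<le> b \<and> f v \<le> b"
  shows "\<forall>a\<in>set (encode f p T). a \<le> b"
  using assms
proof (induction T arbitrary: p)
  case (Leaf z)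
  then show ?case by simp
next
  case (Node v yes no)
  let ?q = "p + 2 + length (encode f (p + 2) yes)"
  have "p + 2 + length (encode f (p + 2) yes) \<le> b" "?q + length (encode f ?q no) \<le> b"
    using Node.prems(1) by (auto simp: Let_def)
  moreover from this have "\<forall>a\<in>set (encode f (p + 2) yes). a \<le> b" "\<forall>a\<in>set (encode f ?q no). a \<le> b"
    using Node.prems(2) by (intro Node.IH; simp)+
  moreover have "f v \<le> b" using Node.prems(2) by simp
  ultimately show ?case by (auto simp: Let_def)
qed

lemma stride_less:
  fixes v :: nat
  assumes "v < n" "i < k"
  shows "v * k + i < n * k"
proof -
  have "v * k + i < Suc v * k" using assms(2) by simp
  also have "\<dots> \<le> n * k" using assms(1) by (intro mult_le_mono1) simp
  finally show ?thesis .
qed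

text \<open>A table entry 0 encodes the answer yes; any other entry is the address of the dictionary of a
  set. A dictionary consists of the two displacement tables, which hold absolute addresses, and of
  a hash table, in which \<open>n\<close> marks an empty cell.\<close>

lemma exists_order_table:
  fixes r :: "nat rel"
  assumes L: "partial_lattice {..<n} r" and top: "has_top {..<n} r" and nq: "n \<le> q * q" "0 < q" "q \<le> n"
  shows "\<exists>M f b. length M \<le> 25 * n * q \<and> 2 + n \<le> length M \<and> (\<forall>a\<in>set M. a \<le> length M) \<and>
    M ! 0 = length M \<and> M ! 1 = q \<and>
    (\<forall>v<n. f v \<le> length M) \<and> (\<forall>x<n. M ! (x + 2) = b x) \<and>
    (\<forall>v<n. \<forall>x<n. \<forall>N. order_safe (M @ N) (f v + b x) (x div q) (x mod q) \<and>
      (order_test (M @ N) (f v + b x) (x div q) (x mod q) x \<longleftrightarrow> (x, v) \<in> r))"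
proof -
  obtain k b and E :: "nat \<Rightarrow> nat \<Rightarrow> nat option" and X
    where tab: "k \<le> q + 1" "\<forall>x<n. b x < k" "\<forall>m. X m \<subseteq> {..<n} \<and> card (X m) \<le> q"
      "\<forall>v i m. E v i = Some m \<longrightarrow> m \<le> n"
      "\<forall>x<n. \<forall>v<n. (x, v) \<in> r \<longleftrightarrow> (\<forall>m. E v (b x) = Some m \<longrightarrow> x \<in> X m)"
    using exists_order_oracle[OF L top nq(1,2)] by (elim exE conjE)
  note k = tab(1) and b = tab(2)[rule_format] and E = tab(4)[rule_format]
    and E_iff = tab(5)[rule_format]
  have X: "X m \<subseteq> {..<n}" "card (X m) \<le> q" for m using tab(3) by simp_all
  have "\<forall>m. \<exists>d e. (\<forall>j. d j < q) \<and> (\<forall>a. e a < 4 * q + 1) \<and> inj_on (dict_pos q d e) (X m)"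
  proof
    fix m
    have "X m \<subseteq> {..<q * q}" using X(1)[of m] nq(1) by auto
    then show "\<exists>d e. (\<forall>j. d j < q) \<and> (\<forall>a. e a < 4 * q + 1) \<and> inj_on (dict_pos q d e) (X m)"
      using X(2) nq(2) by (rule exists_dictionary)
  qed
  then obtain d e where d: "\<And>m j. d m j < q" and e: "\<And>m a. e m a < 4 * q + 1"
    and inj: "\<And>m. inj_on (dict_pos q (d m) (e m)) (X m)" by metis
  define pos where "pos m = dict_pos q (d m) (e m)" for m
  define W where "W = 8 * q + 1"
  define A1 where "A1 = 2 + n"
  define A2 where "A2 = A1 + n * k"
  define A3 where "A3 = A2 + Suc n * W"
  define row where "row m = A2 + m * W" for m
  define V where "V m p = (if p \<in> pos m ` X m then inv_into (X m) (pos m) p else n)" for m p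
  define cell where "cell m c =
    (if c < q then row m + q + d m c
     else if c < 3 * q then row m + 3 * q + e m (c - q) else V m (c - 3 * q))" for m c
  define mem where "mem a =
    (if a = 0 then A3 else if a = 1 then q else if a < A1 then b (a - 2)
     else if a < A2 then (case E ((a - A1) div k) ((a - A1) mod k) of None \<Rightarrow> 0 | Some m \<Rightarrow> row m)
     else cell ((a - A2) div W) ((a - A2) mod W))" for a
  define M where "M = map mem [0..<A3]"
  define f where "f v = A1 + v * k" for v
  have len: "length M = A3" by (simp add: M_def)
  have M: "(M @ N) ! a = mem a" if "a < A3" for a N using that by (simp add: M_def nth_append)
  have "W > 0" by (simp add: W_def)
  have row_less: "row m + c < A3" "row m + c \<ge> A2" if "m \<le> n" "c < W" for m c
    using stride_less[of m "Suc n" c W] that by (simp_all add: row_def A3_def)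
  have M_row: "(M @ N) ! (row m + c) = cell m c" if "m \<le> n" "c < W" for m c N
    using row_less[OF that] that(2) M[of "row m + c"]
    by (simp add: mem_def row_def A1_def A2_def)
  have f_less: "f v + i < A2" "A1 \<le> f v + i" if "v < n" "i < k" for v i
    using stride_less[OF that] by (simp_all add: f_def A2_def)
  have M_E: "(M @ N) ! (f v + i) = (case E v i of None \<Rightarrow> 0 | Some m \<Rightarrow> row m)"
    if "v < n" "i < k" for v i N
  proof -
    have "f v + i < A3" using f_less[OF that] by (simp add: A3_def)
    then show ?thesis using M[of "f v + i" N] f_less[OF that] that(2)
      by (simp add: mem_def A1_def) (simp add: f_def A1_def)
  qed
  have V: "V m (pos m x) = x \<longleftrightarrow> x \<in> X m" if "x < n" for m x
  proof (cases "pos m x \<in> pos m ` X m")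
    case True
    then have "inv_into (X m) (pos m) (pos m x) \<in> X m" by (rule inv_into_into)
    then show ?thesis using True inv_into_f_f[OF inj, of x m] unfolding V_def pos_def by metis
  next
    case False
    then show ?thesis using that by (auto simp: V_def)
  qed
  have V_le: "V m p \<le> n" for m p
    using inv_into_into[of p "pos m" "X m"] X(1)[of m] by (auto simp: V_def less_imp_le subset_iff)
  have cell_le: "cell m c \<le> A3" if "m \<le> n" "c < W" for m c
  proof -
    have "q + d m c < W" "3 * q + e m (c - q) < W"
      using d[of m c] e[of m "c - q"] by (auto simp: W_def)
    then have "row m + (q + d m c) < A3" "row m + (3 * q + e m (c - q)) < A3"
      using row_less(1)[OF that(1)] by blast+
    then show ?thesis using V_le[of m "c - 3 * q"] by (simp add: cell_def A3_def A2_def A1_def)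
  qed
  have mem_le: "mem a \<le> A3" if "a < A3" for a
  proof -
    have "b (a - 2) \<le> A3" if "\<not> a \<le> 1" "a < A1"
    proof -
      have "b (a - 2) < k" using that by (intro b) (simp add: A1_def)
      also have "k \<le> n * k" using nq by simp
      finally show ?thesis by (simp add: A3_def A2_def)
    qed
    moreover have "row m \<le> A3" if "E v i = Some m" for v i m
      using row_less(1)[OF E[OF that] \<open>W > 0\<close>] by simp
    moreover have "cell ((a - A2) div W) ((a - A2) mod W) \<le> A3" if "\<not> a < A2"
    proof (rule cell_le)
      have "a - A2 < Suc n * W" using \<open>a < A3\<close> that by (simp add: A3_def)
      then have "(a - A2) div W < Suc n" by (rule less_mult_imp_div_less)
      then show "(a - A2) div W \<le> n" by simp
      show "(a - A2) mod W < W" using \<open>W > 0\<close> by simp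
    qed
    moreover have "q \<le> A3" using nq by (simp add: A3_def A2_def A1_def)
    ultimately show ?thesis by (auto simp: mem_def split: option.split)
  qed
  have order: "order_safe (M @ N) (f v + b x) (x div q) (x mod q) \<and>
      (order_test (M @ N) (f v + b x) (x div q) (x mod q) x \<longleftrightarrow> (x, v) \<in> r)"
    if "v < n" "x < n" for v x N
  proof (cases "E v (b x)")
    case None
    then show ?thesis
      using M_E[OF that(1) b[OF that(2)], of N] f_less[OF that(1) b[OF that(2)]] E_iff[OF that(2,1)]
      by (simp add: order_safe_def order_test_def len A3_def)
  next
    case (Some m)
    let ?i = "x div q" and ?j = "x mod q"
    have m: "m \<le> n" using E[OF Some] .
    have ij: "?j < q" "?i < q" using nq that by (auto simp: less_mult_imp_div_less)
    define o1 where "o1 = q + d m ?j + ?i"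
    define o2 where "o2 = 3 * q + pos m x"
    have W: "?j < W" "o1 < W" "o2 < W"
      using ij d[of m ?j] e[of m "?i + d m ?j"] unfolding W_def o1_def o2_def pos_def dict_pos_def by linarith+
    have 0: "(M @ N) ! (f v + b x) = row m"
      using M_E[OF that(1) b[OF that(2)]] Some by simp
    have 1: "(M @ N) ! (row m + ?j) + ?i = row m + o1"
      using M_row[OF m W(1), of N] ij by (simp add: cell_def o1_def)
    have 2: "(M @ N) ! (row m + o1) + ?j = row m + o2"
      using M_row[OF m W(2), of N] ij d[of m ?j]
      by (simp add: cell_def o1_def o2_def pos_def dict_pos_def add.commute)
    have 3: "(M @ N) ! (row m + o2) = V m (pos m x)"
      using M_row[OF m W(3), of N] by (simp add: cell_def o2_def)
    have "row m \<noteq> 0" by (simp add: row_def A2_def A1_def)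
    then have "order_test (M @ N) (f v + b x) ?i ?j x \<longleftrightarrow> (x, v) \<in> r"
      using V[OF that(2)] E_iff[OF that(2,1)] Some by (simp add: order_test_def 0 1 2 3)
    moreover have "order_safe (M @ N) (f v + b x) ?i ?j"
      using row_less(1)[OF m W(1)] row_less(1)[OF m W(2)] row_less(1)[OF m W(3)]
        f_less(1)[OF that(1) b[OF that(2)]]
      unfolding order_safe_def 0 1 2 by (simp add: len A3_def)
    ultimately show ?thesis by blast
  qed
  have "length M \<le> 25 * n * q"
  proof -
    have "n * 1 \<le> n * q" "1 * 1 \<le> n * q" using nq by (intro mult_le_mono; simp)+
    moreover have "n * k \<le> n * (2 * q)" using k nq by (intro mult_le_mono2) simp
    moreover have "Suc n * W \<le> (2 * n) * (9 * q)" using nq by (intro mult_le_mono) (auto simp: W_def)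
    moreover have "n * (2 * q) = 2 * (n * q)" "(2 * n) * (9 * q) = 18 * (n * q)" "25 * n * q = 25 * (n * q)"
      by simp_all
    moreover have "length M = 2 + n + n * k + Suc n * W" by (simp only: len A3_def A2_def A1_def)
    ultimately show ?thesis by linarith
  qed
  moreover have "2 + n \<le> length M" by (simp add: len A3_def A2_def A1_def)
  moreover have "\<forall>a\<in>set M. a \<le> length M" using mem_le by (auto simp: M_def)
  moreover have "M ! 0 = length M" using M[of 0 "[]"] by (simp add: len mem_def A3_def A2_def A1_def)
  moreover have "M ! 1 = q" using M[of 1 "[]"] by (simp add: mem_def A3_def A2_def A1_def)
  moreover have "\<forall>v<n. f v \<le> length M"
  proof (intro allI impI)
    fix v assume "v < n"
    have "v * k \<le> n * k" using \<open>v < n\<close> by (intro mult_le_mono1) simp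
    then show "f v \<le> length M" unfolding f_def len A3_def A2_def by linarith
  qed
  moreover have "\<forall>x<n. M ! (x + 2) = b x"
  proof (intro allI impI)
    fix x assume "x < n"
    then show "M ! (x + 2) = b x" using M[of "x + 2" "[]"] by (simp add: mem_def A3_def A2_def A1_def)
  qed
  ultimately show ?thesis using order by blast
qed

subsection \<open>Bounds\<close>

lemma degree_le_max_degree:
  assumes "finite A" "v \<in> A"
  shows "degree A r v \<le> max_degree A r"
  using assms by (simp add: max_degree_def)

lemma max_degree_pos:
  assumes L: "partial_lattice A r" and "(x, t) \<in> r" "x \<noteq> t"
  shows "1 \<le> max_degree A r"
proof -
  note L' = partial_latticeD[OF L]
  obtain u where "(u, t) \<in> transitive_reduction A r"
    using exists_cover[OF L, of x t] assms(2,3) by (auto simp: less_in_def)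
  moreover have "finite {u. (u, t) \<in> transitive_reduction A r}"
    by (rule finite_subset[OF _ L'(1)]) (auto simp: transitive_reduction_def)
  ultimately have "0 < degree A r t" by (auto simp: degree_def card_gt_0_iff)
  also have "\<dots> \<le> max_degree A r"
    using L'(1,3) assms(2) by (intro degree_le_max_degree) auto
  finally show ?thesis by simp
qed

lemma depth_le_join_time:
  assumes "1 \<le> n" "n = 1 \<or> 1 \<le> d"
  shows "depth_const (max 2 d) * log 2 (real n) \<le> 10 * join_time n d"
proof (cases "n = 1")
  case True
  then show ?thesis by (simp add: join_time_def)
next
  case False
  then have "1 \<le> d" using assms by simp
  then have "real (max 2 d) \<le> 2 * real d" by simp
  have "depth_const (max 2 d) * log 2 (real n) =
      5 * real (max 2 d) * (log 2 (real n) / log 2 (real (max 2 d)))"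
    by (simp add: depth_const_def)
  also have "\<dots> \<le> 5 * (2 * real d) * (log 2 (real n) / log 2 (real (max 2 d)))"
    using \<open>real (max 2 d) \<le> 2 * real d\<close> assms(1)
    by (intro mult_right_mono mult_left_mono divide_nonneg_nonneg) auto
  also have "\<dots> \<le> 10 * join_time n d" by (simp add: join_time_def)
  finally show ?thesis .
qed

lemma exists_sqrt_bound:
  assumes "1 \<le> (n :: nat)"
  shows "\<exists>q. n \<le> q * q \<and> 0 < q \<and> q \<le> n \<and> real q \<le> 2 * sqrt (real n)"
proof -
  define q where "q = nat \<lceil>sqrt (real n)\<rceil>"
  have s: "1 \<le> sqrt (real n)" "sqrt (real n) \<le> real n"
    using assms by (simp_all add: real_le_lsqrt power2_eq_square)
  have q: "sqrt (real n) \<le> real q" "real q < sqrt (real n) + 1"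
    using s(1) unfolding q_def by linarith+
  have "real n = sqrt (real n) * sqrt (real n)" by simp
  also have "\<dots> \<le> real q * real q" using q s by (intro mult_mono) auto
  finally have "n \<le> q * q" by (metis of_nat_le_iff of_nat_mult)
  moreover have "0 < q" "q \<le> n" "real q \<le> 2 * sqrt (real n)" using q s by linarith+
  ultimately show ?thesis by blast
qed

lemma word_length_bound:
  assumes "8 * log 2 (real n + 1) \<le> real w" "1 \<le> n"
  shows "2 \<le> w" "29 * n * n < 2 ^ w"
proof -
  have "1 \<le> log 2 (real n + 1)" using assms(2) by (simp add: le_log_iff)
  then have "8 \<le> real w" using assms(1) by linarith
  then show "2 \<le> w" by simp
  have "real ((n + 1) ^ 8) = (real n + 1) powr 8" by (simp add: powr_realpow add.commute)
  also have "\<dots> = 2 powr (8 * log 2 (real n + 1))"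
    by (simp add: powr_powr[symmetric] mult.commute[of 8] del: powr_numeral)
  also have "\<dots> \<le> 2 powr real w" using assms(1) by simp
  also have "\<dots> = real (2 ^ w)" by (simp add: powr_realpow)
  finally have w: "(n + 1) ^ 8 \<le> 2 ^ w" by (simp only: of_nat_le_iff)
  have "(2 :: nat) ^ 6 \<le> (n + 1) ^ 6" using assms(2) by (intro power_mono) auto
  then have "2 ^ 6 * (n * n) \<le> (n + 1) ^ 6 * ((n + 1) * (n + 1))"
    by (intro mult_le_mono) auto
  also have "\<dots> = (n + 1) ^ (6 + 2)" unfolding power_add power2_eq_square ..
  finally have "64 * (n * n) \<le> 2 ^ w" using w by simp
  moreover have "0 < n * n" "29 * n * n = 29 * (n * n)" using assms(2) by simp_all
  ultimately show "29 * n * n < 2 ^ w" by linarith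
qed

lemma exists_join_structure:
  assumes L: "partial_lattice {..<n} r" and top: "has_top {..<n} r"
    and w: "8 * log 2 (real n + 1) \<le> real w"
  shows "\<exists>M. join_structure w join_prog n r M (300 * real n powr (3 / 2))
    (300 * join_time n (max_degree {..<n} r))"
proof -
  define d where "d = max_degree {..<n} r"
  obtain t where t: "t < n" "\<And>x. x < n \<Longrightarrow> (x, t) \<in> r" using top by (auto simp: has_top_def)
  then have n: "1 \<le> n" by simp
  note L' = partial_latticeD[OF L]
  obtain q where q: "n \<le> q * q" "0 < q" "q \<le> n" "real q \<le> 2 * sqrt (real n)"
    using exists_sqrt_bound[OF n] by blast
  obtain M0 f b where M0: "length M0 \<le> 25 * n * q" "2 + n \<le> length M0"
    "\<forall>a\<in>set M0. a \<le> length M0" "M0 ! 0 = length M0" "M0 ! 1 = q"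
    "\<forall>v<n. f v \<le> length M0" "\<forall>x<n. M0 ! (x + 2) = b x"
    and order: "\<forall>v<n. \<forall>x<n. \<forall>N. order_safe (M0 @ N) (f v + b x) (x div q) (x mod q) \<and>
      (order_test (M0 @ N) (f v + b x) (x div q) (x mod q) x \<longleftrightarrow> (x, v) \<in> r)"
    using exists_order_table[OF L top q(1-3)] by (elim exE conjE)
  note order = order[rule_format]
  have all: "{x. (x, t) \<in> r} - {} = {..<n}" using t(2) L'(3) by auto
  have "\<exists>T. identifies r ({x. (x, t) \<in> r} - {}) T \<and>
      real (depth T) \<le> depth_const (max 2 d) * log 2 (card ({x. (x, t) \<in> r} - {}))"
  proof (rule exists_tree[OF L])
    fix v assume "v \<in> {..<n}"
    then show "degree {..<n} r v \<le> max 2 d"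
      using degree_le_max_degree[of "{..<n}" v r] by (simp add: d_def)
  qed (use t in auto)
  then obtain T where T: "identifies r {..<n} T"
    "real (depth T) \<le> depth_const (max 2 d) * log 2 (real n)"
    unfolding all by auto
  define N where "N = encode f (length M0) T"
  define M where "M = M0 @ N"
  have len: "length M \<le> 29 * n * q"
  proof -
    have "length N \<le> 4 * n"
      using length_encode[of f "length M0" T] leaves_identifies[OF T(1)] by (simp add: N_def)
    moreover have "n * 1 \<le> n * q" using q(2) by (intro mult_le_mono2) simp
    moreover have "29 * n * q = 25 * n * q + 4 * (n * q)" by simp
    moreover have "length M = length M0 + length N" by (simp add: M_def)
    ultimately show ?thesis using M0(1) by linarith
  qed
  have labels: "v < n" if "v \<in> set_dtree T" for v
    using set_dtree_identifies[OF T(1)] that by auto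
  have "29 * n * q \<le> 29 * n * n" using q(3) by (intro mult_le_mono2)
  then have len_w: "length M < 2 ^ w" using len word_length_bound(2)[OF w n] by linarith
  have stored: "stored M f (M ! 0) T"
    using stored_encode[of M0 f T "[]"] M0(2,4) by (auto simp: M_def N_def nth_append)
  have M_nth: "M ! 1 = q" "\<And>x. x < n \<Longrightarrow> M ! (x + 2) = b x"
    using M0(2,5,7) by (auto simp: M_def nth_append)
  have "real (length M) \<le> 300 * real n powr (3 / 2)"
  proof -
    have "real (length M) \<le> real (29 * n * q)" using len by (simp only: of_nat_le_iff)
    also have "\<dots> = 29 * real n * real q" by simp
    also have "\<dots> \<le> 29 * real n * (2 * sqrt (real n))"
      using q(4) by (intro mult_left_mono) simp_all
    also have "\<dots> = 58 * (real n powr 1 * real n powr (1 / 2))"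
      using n by (simp add: powr_half_sqrt)
    also have "real n powr 1 * real n powr (1 / 2) = real n powr (3 / 2)"
      by (subst powr_add[symmetric]) simp
    finally show ?thesis using powr_ge_zero[of "real n" "3 / 2"] by linarith
  qed
  moreover have "\<forall>v\<in>set M. v < 2 ^ w"
  proof
    fix a assume a: "a \<in> set M"
    have "\<forall>a\<in>set N. a \<le> length M"
      unfolding N_def
    proof (rule encode_le)
      show "length M0 + length (encode f (length M0) T) \<le> length M" by (simp add: M_def N_def)
      show "v \<le> length M \<and> f v \<le> length M" if "v \<in> set_dtree T" for v
        using labels[OF that] M0(2) M0(6) by (auto simp: M_def intro: trans_le_add1)
    qed
    with a M0(3) have "a \<le> length M" by (fastforce simp: M_def)
    with len_w show "a < 2 ^ w" by linarith
  qed
  moreover have "\<exists>s z. answers w join_prog M x y s z \<and> is_join {..<n} r x y z \<and>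
      real s \<le> 300 * join_time n d" if "x < n" "y < n" for x y
  proof -
    let ?test = "\<lambda>v. order_test M (f v + b x) (x div q) (x mod q) x \<and>
        order_test M (f v + b y) (y div q) (y mod q) y"
    have "\<exists>s\<le>27 * depth T + 18. answers w join_prog M x y s (search ?test T)"
    proof (rule answers_join_prog[OF stored])
      show "length M \<le> 2 ^ w" "2 \<le> w" using len_w word_length_bound(1)[OF w n] by simp_all
      show "x + 2 < length M" "y + 2 < length M" using that M0(2) by (simp_all add: M_def)
      show "q = M ! 1" "b x = M ! (x + 2)" "b y = M ! (y + 2)" using M_nth that by simp_all
      show "order_safe M (f v + b x) (x div q) (x mod q) \<and> order_safe M (f v + b y) (y div q) (y mod q)"
        if "v \<in> set_dtree T" for v
        using order[OF labels[OF that] \<open>x < n\<close>] order[OF labels[OF that] \<open>y < n\<close>] by (simp add: M_def)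
    qed
    then obtain s where s: "s \<le> 27 * depth T + 18" "answers w join_prog M x y s (search ?test T)" by blast
    obtain z where z: "is_join {..<n} r x y z"
      using exists_join[OF L t(2)[OF \<open>x < n\<close>] t(2)[OF \<open>y < n\<close>]] by blast
    have "search ?test T = z"
    proof (rule search_identifies[OF T(1)])
      show "z \<in> {..<n}" using z by (simp add: is_join_def)
      fix v assume "v \<in> set_dtree T"
      then have v: "v < n" by (rule labels)
      have "(z, v) \<in> r \<longleftrightarrow> (x, v) \<in> r \<and> (y, v) \<in> r"
        using z v L'(4)[of x z v] L'(4)[of y z v] unfolding is_join_def by blast
      then show "?test v \<longleftrightarrow> (z, v) \<in> r" using order[OF v that(1)] order[OF v that(2)] by (simp add: M_def)
    qed
    moreover have "real s \<le> 300 * join_time n d"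
    proof -
      have "n = 1 \<or> 1 \<le> d"
      proof (cases "n = 1")
        case False
        define u where "u = (if t = 0 then 1 else 0 :: nat)"
        have "u < n" "u \<noteq> t" using False n by (auto simp: u_def)
        then show ?thesis using max_degree_pos[OF L t(2)] by (simp add: d_def)
      qed simp
      then have "real (depth T) \<le> 10 * join_time n d"
        using T(2) depth_le_join_time[OF n, of d] by linarith
      moreover have "1 \<le> join_time n d" by (simp add: join_time_def)
      moreover have "real s \<le> 27 * real (depth T) + 18" using s(1) by linarith
      ultimately show ?thesis by linarith
    qed
    ultimately show ?thesis using s(2) z by blast
  qed
  ultimately show ?thesis unfolding join_structure_def d_def by blast
qed

theorem theorem12:
  "\<exists>a\<ge>1. \<forall>b\<ge>a. \<exists>(P :: program) (C :: real). \<forall>(n :: nat) (w :: nat) (r :: nat rel).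
     a * log 2 (real n + 1) \<le> real w \<and> real w \<le> b * log 2 (real n + 1) \<and>
     partial_lattice {..<n} r \<and> has_top {..<n} r \<longrightarrow>
     (\<exists>M. join_structure w P n r M
            (C * real n powr (3 / 2))
            (C * join_time n (max_degree {..<n} r)))"
proof (intro exI[of _ 8] conjI allI impI)
  fix b :: real
  show "\<exists>(P :: program) (C :: real). \<forall>(n :: nat) (w :: nat) (r :: nat rel).
     8 * log 2 (real n + 1) \<le> real w \<and> real w \<le> b * log 2 (real n + 1) \<and>
     partial_lattice {..<n} r \<and> has_top {..<n} r \<longrightarrow>
     (\<exists>M. join_structure w P n r M
            (C * real n powr (3 / 2))
            (C * join_time n (max_degree {..<n} r)))"
    using exists_join_structure by blast
qed simp

end
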